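(* Let $(V,\delta)$ be a coassociative coalgebra over a field $\Bbbk$ (not necessarily counital), and extend it to a counital one $(\widetilde V,\Delta,\varepsilon)$ with $\widetilde V=V\oplus\Bbbk\mathbf 1$. Then the group-like element $\mathbf 1$, used as braided co-character for the pre-braiding $\sigma_{coAss}=\varepsilon\otimes\Delta$ on $\widetilde V$, gives as left braided differential ${}_{\mathbf 1}d$ the following differential on $T(\widetilde V)$: $${}_{\mathbf 1}d(v_1\ldots v_n)=\mathbf 1v_1\ldots v_n+\sum_{i=1}^n(-1)^iv_1\ldots v_{i-1}\Delta(v_i)v_{i+1}\ldots v_n.$$ The ideal $I_{\mathbf 1}$ of the tensor algebra $T(\widetilde V)$ generated by the element $\mathbf 1$ is ${}_{\mathbf 1}d$-stable. The differential induced on $T(\widetilde V)/I_{\mathbf 1}\simeq T(\widetilde V/\Bbbk\mathbf 1)\simeq T(V)$ is $$\widetilde{{}_{\mathbf 1}d}(v_1\ldots v_n)=\sum_{i=1}^n(-1)^iv_1\ldots v_{i-1}\delta(v_i)v_{i+1}\ldots v_n.$$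
   Context: $T(W)=\bigoplus_{n\ge0}W^{\otimes n}$ and $v_1\ldots v_n$ denotes $v_1\otimes\cdots\otimes v_n$. The extension: $\mathbf 1$ is a formal new basis element, $\Delta(v)=\delta(v)+\mathbf 1\otimes v+v\otimes\mathbf 1$ for $v\in V$, $\Delta(\mathbf 1)=\mathbf 1\otimes\mathbf 1$, and $\varepsilon(V)=0$, $\varepsilon(\mathbf 1)=1$. Here $\mathbf 1\in\widetilde V$ has tensor degree $1$ and is distinct from the unit of $T(\widetilde V)$ in degree $0$. A pre-braiding on $W$ is a linear map $\sigma:W\otimes W\to W\otimes W$ satisfying the Yang-Baxter equation $\sigma_1\sigma_2\sigma_1=\sigma_2\sigma_1\sigma_2$, where $\sigma_i$ is $\sigma$ applied to the factors $i,i+1$. Here $\sigma_{coAss}(v\otimes w)=\varepsilon(v)\Delta(w)$. A braided co-character is (identified with) an element $e\in W$ such that $\sigma(e\otimes e)=e\otimes e$. The left braided differential attached to $e$ is the map $W^{\otimes n}\to W^{\otimes(n+1)}$, ${}_ed(\bar v)=\mathrm{sh}^{1,n}_{-\sigma}(e\otimes\bar v)=\sum_{i=0}^n(-1)^i\,\sigma_i\circ\sigma_{i-1}\circ\cdots\circ\sigma_1(e\otimes\bar v)$. *)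

theory Defs
  imports Complex_Main "HOL-Algebra.QuotRing" "HOL-Library.Poly_Mapping" "HOL-Library.Product_Plus"
begin

section \<open>The tensor algebra\<close>

text \<open>
  A vector space over a field \<open>'k\<close> is an additive group type \<open>'w\<close> with a scalar
  multiplication \<open>s :: 'k \<Rightarrow> 'w \<Rightarrow> 'w\<close> satisfying \<^locale>\<open>vector_space\<close>.
  Its tensor algebra is the free associative unital algebra on the set \<open>'w\<close>
  modulo the relations making the canonical map from \<open>'w\<close> linear.

  Lists form a monoid under concatenation with neutral element \<open>[]\<close>, so that the convolution
  product of \<^theory>\<open>HOL-Library.Poly_Mapping\<close> makes \<open>'w list \<Rightarrow>\<^sub>0 'k\<close> that free algebra.
\<close>

instantiation list :: (type) monoid_add
begin

definition zero_list :: "'a list" where "zero_list = []"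

definition plus_list :: "'a list \<Rightarrow> 'a list \<Rightarrow> 'a list" where "plus_list = (@)"

instance by standard (simp_all add: zero_list_def plus_list_def)

end

definition free_algebra :: "('w list \<Rightarrow>\<^sub>0 'k::field) ring" where
  "free_algebra = \<lparr>carrier = UNIV, mult = (*), one = 1, zero = 0, add = (+)\<rparr>"

definition gen :: "'w \<Rightarrow> 'w list \<Rightarrow>\<^sub>0 'k::field" where
  "gen w = Poly_Mapping.single [w] 1"

definition tensor_relations ::
  "('k::field \<Rightarrow> 'w::ab_group_add \<Rightarrow> 'w) \<Rightarrow> ('w list \<Rightarrow>\<^sub>0 'k) set" where
  "tensor_relations s =
     {gen (v + w) - gen v - gen w | v w. True} \<union>
     {gen (s c v) - Poly_Mapping.single [] c * gen v | c v. True}"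

definition tensor_ideal ::
  "('k::field \<Rightarrow> 'w::ab_group_add \<Rightarrow> 'w) \<Rightarrow> ('w list \<Rightarrow>\<^sub>0 'k) set" where
  "tensor_ideal s = Idl\<^bsub>free_algebra\<^esub> (tensor_relations s)"

definition tensor_algebra ::
  "('k::field \<Rightarrow> 'w::ab_group_add \<Rightarrow> 'w) \<Rightarrow> ('w list \<Rightarrow>\<^sub>0 'k) set ring" where
  "tensor_algebra s = free_algebra Quot (tensor_ideal s)"

definition tclass ::
  "('k::field \<Rightarrow> 'w::ab_group_add \<Rightarrow> 'w) \<Rightarrow> ('w list \<Rightarrow>\<^sub>0 'k) \<Rightarrow> ('w list \<Rightarrow>\<^sub>0 'k) set" where
  "tclass s p = tensor_ideal s +>\<^bsub>free_algebra\<^esub> p"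

text \<open>\<open>pure s [v\<^sub>1, \<dots>, v\<^sub>n]\<close> is \<open>v\<^sub>1 \<otimes> \<dots> \<otimes> v\<^sub>n\<close>; in particular \<open>pure s []\<close> is the unit.\<close>

definition pure ::
  "('k::field \<Rightarrow> 'w::ab_group_add \<Rightarrow> 'w) \<Rightarrow> 'w list \<Rightarrow> ('w list \<Rightarrow>\<^sub>0 'k) set" where
  "pure s ws = tclass s (Poly_Mapping.single ws 1)"

text \<open>The structure map from the ground field, identified with the tensors of degree \<open>0\<close>.\<close>

definition tscalar ::
  "('k::field \<Rightarrow> 'w::ab_group_add \<Rightarrow> 'w) \<Rightarrow> 'k \<Rightarrow> ('w list \<Rightarrow>\<^sub>0 'k) set" where
  "tscalar s c = tclass s (Poly_Mapping.single [] c)"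

definition tscale ::
  "('k::field \<Rightarrow> 'w::ab_group_add \<Rightarrow> 'w) \<Rightarrow> 'k \<Rightarrow>
   ('w list \<Rightarrow>\<^sub>0 'k) set \<Rightarrow> ('w list \<Rightarrow>\<^sub>0 'k) set" where
  "tscale s c x = tscalar s c \<otimes>\<^bsub>tensor_algebra s\<^esub> x"

text \<open>The tensor power \<open>W\<^sup>\<otimes>\<^sup>n\<close>, as the homogeneous component of degree \<open>n\<close>. The tensor product
  of elements of two tensor powers is their product in the tensor algebra.\<close>

definition tpow ::
  "('k::field \<Rightarrow> 'w::ab_group_add \<Rightarrow> 'w) \<Rightarrow> nat \<Rightarrow> ('w list \<Rightarrow>\<^sub>0 'k) set set" where
  "tpow s n = tclass s ` {p. \<forall>ws\<in>Poly_Mapping.keys p. length ws = n}"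


section \<open>Linear maps on tensors\<close>

definition tensor_linear_on ::
  "('k::field \<Rightarrow> 'w::ab_group_add \<Rightarrow> 'w) \<Rightarrow> ('k \<Rightarrow> 'u::ab_group_add \<Rightarrow> 'u) \<Rightarrow>
   ('w list \<Rightarrow>\<^sub>0 'k) set set \<Rightarrow> ('u list \<Rightarrow>\<^sub>0 'k) set set \<Rightarrow>
   (('w list \<Rightarrow>\<^sub>0 'k) set \<Rightarrow> ('u list \<Rightarrow>\<^sub>0 'k) set) \<Rightarrow> bool" where
  "tensor_linear_on s t A B f \<longleftrightarrow>
     f ` A \<subseteq> B \<and>
     (\<forall>x\<in>A. \<forall>y\<in>A. f (x \<oplus>\<^bsub>tensor_algebra s\<^esub> y) = f x \<oplus>\<^bsub>tensor_algebra t\<^esub> f y) \<and>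
     (\<forall>c. \<forall>x\<in>A. f (tscale s c x) = tscale t c (f x))"

definition linear_into_tpow ::
  "('k::field \<Rightarrow> 'w::ab_group_add \<Rightarrow> 'w) \<Rightarrow> nat \<Rightarrow> ('w \<Rightarrow> ('w list \<Rightarrow>\<^sub>0 'k) set) \<Rightarrow> bool" where
  "linear_into_tpow s n f \<longleftrightarrow>
     (\<forall>v. f v \<in> tpow s n) \<and>
     (\<forall>v w. f (v + w) = f v \<oplus>\<^bsub>tensor_algebra s\<^esub> f w) \<and>
     (\<forall>c v. f (s c v) = tscale s c (f v))"

text \<open>
  \<open>lin_ext t F\<close> is the linear map into the tensor algebra of \<open>t\<close> with
  \<open>v\<^sub>1 \<dots> v\<^sub>n \<mapsto> F [v\<^sub>1, \<dots>, v\<^sub>n]\<close>, for \<open>F\<close> multilinear in the entries of the list for each length.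
  As for the maps on factor rings in \<^theory>\<open>HOL-Algebra.QuotRing\<close>, the value at a coset is
  the common value of the linear extension at its representatives.
\<close>

definition lin_ext ::
  "('k::field \<Rightarrow> 'u::ab_group_add \<Rightarrow> 'u) \<Rightarrow> ('w list \<Rightarrow> ('u list \<Rightarrow>\<^sub>0 'k) set) \<Rightarrow>
   ('w list \<Rightarrow>\<^sub>0 'k) set \<Rightarrow> ('u list \<Rightarrow>\<^sub>0 'k) set" where
  "lin_ext t F X =
     the_elem ((\<lambda>p. \<Oplus>\<^bsub>tensor_algebra t\<^esub> ws\<in>Poly_Mapping.keys p. tscale t (Poly_Mapping.lookup p ws) (F ws)) ` X)"

text \<open>The algebra homomorphism \<open>T(f)\<close> induced by a linear map \<open>f\<close>.\<close>

definition tmap ::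
  "('k::field \<Rightarrow> 'u::ab_group_add \<Rightarrow> 'u) \<Rightarrow> ('w \<Rightarrow> 'u) \<Rightarrow>
   ('w list \<Rightarrow>\<^sub>0 'k) set \<Rightarrow> ('u list \<Rightarrow>\<^sub>0 'k) set" where
  "tmap t f = lin_ext t (\<lambda>ws. pure t (map f ws))"

text \<open>\<open>f \<otimes> g\<close> on \<open>W \<otimes> W\<close>, for linear maps \<open>f\<close> and \<open>g\<close> from \<open>W\<close> to its tensor algebra.
  The identity of \<open>W\<close> is \<open>\<lambda>v. pure s [v]\<close>.\<close>

definition tensor_maps ::
  "('k::field \<Rightarrow> 'w::ab_group_add \<Rightarrow> 'w) \<Rightarrow> ('w \<Rightarrow> ('w list \<Rightarrow>\<^sub>0 'k) set) \<Rightarrow>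
   ('w \<Rightarrow> ('w list \<Rightarrow>\<^sub>0 'k) set) \<Rightarrow> ('w list \<Rightarrow>\<^sub>0 'k) set \<Rightarrow> ('w list \<Rightarrow>\<^sub>0 'k) set" where
  "tensor_maps s f g =
     lin_ext s (\<lambda>ws. case ws of [v, w] \<Rightarrow> f v \<otimes>\<^bsub>tensor_algebra s\<^esub> g w
                     | _ \<Rightarrow> \<zero>\<^bsub>tensor_algebra s\<^esub>)"


section \<open>Coalgebras\<close>

definition coassociative_coalgebra ::
  "('k::field \<Rightarrow> 'w::ab_group_add \<Rightarrow> 'w) \<Rightarrow> ('w \<Rightarrow> ('w list \<Rightarrow>\<^sub>0 'k) set) \<Rightarrow> bool" where
  "coassociative_coalgebra s \<delta> \<longleftrightarrow>
     vector_space s \<and> linear_into_tpow s 2 \<delta> \<and>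
     (\<forall>v. tensor_maps s \<delta> (\<lambda>w. pure s [w]) (\<delta> v) = tensor_maps s (\<lambda>w. pure s [w]) \<delta> (\<delta> v))"

definition counital_coalgebra ::
  "('k::field \<Rightarrow> 'w::ab_group_add \<Rightarrow> 'w) \<Rightarrow> ('w \<Rightarrow> ('w list \<Rightarrow>\<^sub>0 'k) set) \<Rightarrow> ('w \<Rightarrow> 'k) \<Rightarrow> bool" where
  "counital_coalgebra s \<Delta> \<epsilon> \<longleftrightarrow>
     coassociative_coalgebra s \<Delta> \<and> Vector_Spaces.linear s (*) \<epsilon> \<and>
     (\<forall>v. tensor_maps s (\<lambda>w. tscalar s (\<epsilon> w)) (\<lambda>w. pure s [w]) (\<Delta> v) = pure s [v]) \<and>
     (\<forall>v. tensor_maps s (\<lambda>w. pure s [w]) (\<lambda>w. tscalar s (\<epsilon> w)) (\<Delta> v) = pure s [v])"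

definition group_like ::
  "('k::field \<Rightarrow> 'w::ab_group_add \<Rightarrow> 'w) \<Rightarrow> ('w \<Rightarrow> ('w list \<Rightarrow>\<^sub>0 'k) set) \<Rightarrow> ('w \<Rightarrow> 'k) \<Rightarrow> 'w \<Rightarrow> bool" where
  "group_like s \<Delta> \<epsilon> e \<longleftrightarrow> \<Delta> e = pure s [e, e] \<and> \<epsilon> e = 1"


section \<open>Pre-braidings and braided differentials\<close>

text \<open>\<open>\<sigma>\<^sub>i\<close>, which applies \<open>\<sigma>\<close> to the factors \<open>i\<close> and \<open>i + 1\<close> (counted from \<open>1\<close>). It is only
  meaningful for \<open>1 \<le> i < n\<close> in degree \<open>n\<close>; it is the identity on the other degrees.\<close>

definition braiding_at ::
  "('k::field \<Rightarrow> 'w::ab_group_add \<Rightarrow> 'w) \<Rightarrow> (('w list \<Rightarrow>\<^sub>0 'k) set \<Rightarrow> ('w list \<Rightarrow>\<^sub>0 'k) set) \<Rightarrow>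
   nat \<Rightarrow> ('w list \<Rightarrow>\<^sub>0 'k) set \<Rightarrow> ('w list \<Rightarrow>\<^sub>0 'k) set" where
  "braiding_at s \<sigma> i =
     lin_ext s (\<lambda>ws. if 1 \<le> i \<and> i < length ws
        then pure s (take (i - 1) ws) \<otimes>\<^bsub>tensor_algebra s\<^esub> \<sigma> (pure s [ws ! (i - 1), ws ! i])
               \<otimes>\<^bsub>tensor_algebra s\<^esub> pure s (drop (i + 1) ws)
        else pure s ws)"

definition pre_braiding ::
  "('k::field \<Rightarrow> 'w::ab_group_add \<Rightarrow> 'w) \<Rightarrow>
   (('w list \<Rightarrow>\<^sub>0 'k) set \<Rightarrow> ('w list \<Rightarrow>\<^sub>0 'k) set) \<Rightarrow> bool" where
  "pre_braiding s \<sigma> \<longleftrightarrow>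
     tensor_linear_on s s (tpow s 2) (tpow s 2) \<sigma> \<and>
     (\<forall>x\<in>tpow s 3.
        braiding_at s \<sigma> 1 (braiding_at s \<sigma> 2 (braiding_at s \<sigma> 1 x)) =
        braiding_at s \<sigma> 2 (braiding_at s \<sigma> 1 (braiding_at s \<sigma> 2 x)))"

definition braided_cocharacter ::
  "('k::field \<Rightarrow> 'w::ab_group_add \<Rightarrow> 'w) \<Rightarrow>
   (('w list \<Rightarrow>\<^sub>0 'k) set \<Rightarrow> ('w list \<Rightarrow>\<^sub>0 'k) set) \<Rightarrow> 'w \<Rightarrow> bool" where
  "braided_cocharacter s \<sigma> e \<longleftrightarrow> \<sigma> (pure s [e, e]) = pure s [e, e]"

text \<open>\<open>braiding_chain s \<sigma> i\<close> is \<open>\<sigma>\<^sub>i \<circ> \<sigma>\<^sub>i\<^sub>-\<^sub>1 \<circ> \<dots> \<circ> \<sigma>\<^sub>1\<close>.\<close>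

primrec braiding_chain ::
  "('k::field \<Rightarrow> 'w::ab_group_add \<Rightarrow> 'w) \<Rightarrow> (('w list \<Rightarrow>\<^sub>0 'k) set \<Rightarrow> ('w list \<Rightarrow>\<^sub>0 'k) set) \<Rightarrow>
   nat \<Rightarrow> ('w list \<Rightarrow>\<^sub>0 'k) set \<Rightarrow> ('w list \<Rightarrow>\<^sub>0 'k) set" where
  "braiding_chain s \<sigma> 0 x = x"
| "braiding_chain s \<sigma> (Suc i) x = braiding_at s \<sigma> (Suc i) (braiding_chain s \<sigma> i x)"

text \<open>The left braided differential on \<open>W\<^sup>\<otimes>\<^sup>n\<close>, and the map it defines on the tensor algebra.\<close>

definition left_braided_diff_deg ::
  "('k::field \<Rightarrow> 'w::ab_group_add \<Rightarrow> 'w) \<Rightarrow> (('w list \<Rightarrow>\<^sub>0 'k) set \<Rightarrow> ('w list \<Rightarrow>\<^sub>0 'k) set) \<Rightarrow>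
   'w \<Rightarrow> nat \<Rightarrow> ('w list \<Rightarrow>\<^sub>0 'k) set \<Rightarrow> ('w list \<Rightarrow>\<^sub>0 'k) set" where
  "left_braided_diff_deg s \<sigma> e n x =
     (\<Oplus>\<^bsub>tensor_algebra s\<^esub> i\<in>{0..n}.
        tscale s ((-1) ^ i) (braiding_chain s \<sigma> i (pure s [e] \<otimes>\<^bsub>tensor_algebra s\<^esub> x)))"

definition left_braided_diff ::
  "('k::field \<Rightarrow> 'w::ab_group_add \<Rightarrow> 'w) \<Rightarrow> (('w list \<Rightarrow>\<^sub>0 'k) set \<Rightarrow> ('w list \<Rightarrow>\<^sub>0 'k) set) \<Rightarrow>
   'w \<Rightarrow> ('w list \<Rightarrow>\<^sub>0 'k) set \<Rightarrow> ('w list \<Rightarrow>\<^sub>0 'k) set" where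
  "left_braided_diff s \<sigma> e =
     lin_ext s (\<lambda>ws. left_braided_diff_deg s \<sigma> e (length ws) (pure s ws))"

definition tensor_differential ::
  "('k::field \<Rightarrow> 'w::ab_group_add \<Rightarrow> 'w) \<Rightarrow>
   (('w list \<Rightarrow>\<^sub>0 'k) set \<Rightarrow> ('w list \<Rightarrow>\<^sub>0 'k) set) \<Rightarrow> bool" where
  "tensor_differential s d \<longleftrightarrow>
     tensor_linear_on s s (carrier (tensor_algebra s)) (carrier (tensor_algebra s)) d \<and>
     (\<forall>n. d ` tpow s n \<subseteq> tpow s (n + 1)) \<and>
     (\<forall>x\<in>carrier (tensor_algebra s). d (d x) = \<zero>\<^bsub>tensor_algebra s\<^esub>)"

definition sigma_coAss ::
  "('k::field \<Rightarrow> 'w::ab_group_add \<Rightarrow> 'w) \<Rightarrow> ('w \<Rightarrow> ('w list \<Rightarrow>\<^sub>0 'k) set) \<Rightarrow> ('w \<Rightarrow> 'k) \<Rightarrow>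
   ('w list \<Rightarrow>\<^sub>0 'k) set \<Rightarrow> ('w list \<Rightarrow>\<^sub>0 'k) set" where
  "sigma_coAss s \<Delta> \<epsilon> = tensor_maps s (\<lambda>v. tscalar s (\<epsilon> v)) \<Delta>"


section \<open>The counital extension\<close>

text \<open>\<open>V \<oplus> k\<one>\<close> is the product \<open>'v \<times> 'k\<close>: the vector \<open>v + c\<one>\<close> is encoded as \<open>(v, c)\<close>.\<close>

definition ext_scale ::
  "('k::field \<Rightarrow> 'v::ab_group_add \<Rightarrow> 'v) \<Rightarrow> 'k \<Rightarrow> 'v \<times> 'k \<Rightarrow> 'v \<times> 'k" where
  "ext_scale s c x = (s c (fst x), c * snd x)"

definition ext_incl :: "'v::ab_group_add \<Rightarrow> 'v \<times> 'k::field" where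
  "ext_incl v = (v, 0)"

definition ext_one :: "'v::ab_group_add \<times> 'k::field" where
  "ext_one = (0, 1)"

definition ext_comult ::
  "('k::field \<Rightarrow> 'v::ab_group_add \<Rightarrow> 'v) \<Rightarrow> ('v \<Rightarrow> ('v list \<Rightarrow>\<^sub>0 'k) set) \<Rightarrow>
   'v \<times> 'k \<Rightarrow> (('v \<times> 'k) list \<Rightarrow>\<^sub>0 'k) set" where
  "ext_comult s \<delta> x =
     (let W = ext_scale s; TW = tensor_algebra W; v = ext_incl (fst x)
      in tmap W ext_incl (\<delta> (fst x)) \<oplus>\<^bsub>TW\<^esub> pure W [ext_one, v] \<oplus>\<^bsub>TW\<^esub> pure W [v, ext_one]
           \<oplus>\<^bsub>TW\<^esub> tscale W (snd x) (pure W [ext_one, ext_one]))"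

definition ext_counit :: "'v::ab_group_add \<times> 'k::field \<Rightarrow> 'k" where
  "ext_counit = snd"

definition one_line :: "('v::ab_group_add \<times> 'k::field) set" where
  "one_line = range (\<lambda>c. (0, c))"

lemma diff_in_one_line_iff: "x - y \<in> one_line \<longleftrightarrow> fst x = fst y"
  by (cases x; cases y) (auto simp: one_line_def)

text \<open>The quotient of \<open>V \<oplus> k\<one>\<close> by the line spanned by \<open>\<one>\<close>.\<close>

quotient_type (overloaded) ('v, 'k) ext_quot =
  "'v::ab_group_add \<times> 'k::field" / "\<lambda>x y. x - y \<in> one_line"
  unfolding diff_in_one_line_iff by (rule equivpI) (simp_all add: reflp_def symp_def transp_def)

instantiation ext_quot :: (ab_group_add, field) ab_group_add
begin

lift_definition zero_ext_quot :: "('a, 'b) ext_quot" is 0 .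

lift_definition plus_ext_quot :: "('a, 'b) ext_quot \<Rightarrow> ('a, 'b) ext_quot \<Rightarrow> ('a, 'b) ext_quot"
  is "(+)" by (simp add: diff_in_one_line_iff)

lift_definition minus_ext_quot :: "('a, 'b) ext_quot \<Rightarrow> ('a, 'b) ext_quot \<Rightarrow> ('a, 'b) ext_quot"
  is "(-)" by (simp add: diff_in_one_line_iff)

lift_definition uminus_ext_quot :: "('a, 'b) ext_quot \<Rightarrow> ('a, 'b) ext_quot"
  is uminus by (simp add: diff_in_one_line_iff)

instance proof
  fix a b c :: "('a, 'b) ext_quot"
  show "a + b + c = a + (b + c)"
    by transfer (simp only: diff_in_one_line_iff add.assoc)
  show "a + b = b + a"
    by transfer (simp only: diff_in_one_line_iff add.commute)
  show "0 + a = a"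
    by transfer (simp only: diff_in_one_line_iff add_0_left)
  show "- a + a = 0"
    by transfer (simp only: diff_in_one_line_iff left_minus)
  show "a - b = a + - b"
    by transfer (unfold diff_in_one_line_iff, simp)
qed

end

lift_definition quot_scale ::
  "('k::field \<Rightarrow> 'v::ab_group_add \<Rightarrow> 'v) \<Rightarrow> 'k \<Rightarrow> ('v, 'k) ext_quot \<Rightarrow> ('v, 'k) ext_quot"
  is ext_scale by (simp only: diff_in_one_line_iff ext_scale_def fst_conv)

lift_definition quot_proj :: "'v::ab_group_add \<times> 'k::field \<Rightarrow> ('v, 'k) ext_quot"
  is "\<lambda>x. x" .

text \<open>The identification of the quotient with \<open>V\<close>, sending the class of \<open>v + c\<one>\<close> to \<open>v\<close>.\<close>

lift_definition quot_to_V :: "('v::ab_group_add, 'k::field) ext_quot \<Rightarrow> 'v"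
  is fst by (simp add: diff_in_one_line_iff)


section \<open>Quotients of the tensor algebra\<close>

definition ideal_one ::
  "('k::field \<Rightarrow> 'v::ab_group_add \<Rightarrow> 'v) \<Rightarrow> (('v \<times> 'k) list \<Rightarrow>\<^sub>0 'k) set set" where
  "ideal_one s = Idl\<^bsub>tensor_algebra (ext_scale s)\<^esub> {pure (ext_scale s) [ext_one]}"

text \<open>The map induced on the quotient by \<open>I\<close> by an \<open>I\<close>-stable map \<open>f\<close>, and the map induced on it by
  a map \<open>f\<close> constant on cosets of \<open>I\<close>.\<close>

definition induced_endo :: "('a, 'm) ring_scheme \<Rightarrow> 'a set \<Rightarrow> ('a \<Rightarrow> 'a) \<Rightarrow> 'a set \<Rightarrow> 'a set" where
  "induced_endo R I f X = the_elem ((\<lambda>x. I +>\<^bsub>R\<^esub> f x) ` X)"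

definition induced_map :: "('a \<Rightarrow> 'b) \<Rightarrow> 'a set \<Rightarrow> 'b" where
  "induced_map f X = the_elem (f ` X)"

text \<open>Isomorphisms of algebras over \<open>'k\<close>, given by rings with structure maps from \<open>'k\<close>.\<close>

definition algebra_iso ::
  "('a, 'm) ring_scheme \<Rightarrow> ('k \<Rightarrow> 'a) \<Rightarrow> ('b, 'n) ring_scheme \<Rightarrow> ('k \<Rightarrow> 'b) \<Rightarrow> ('a \<Rightarrow> 'b) \<Rightarrow> bool" where
  "algebra_iso A a B b h \<longleftrightarrow> h \<in> ring_iso A B \<and> (\<forall>c. h (a c) = b c)"

end

theory Submission
  imports Defs
begin

text \<open>
  For the pre-braiding \<open>\<sigma> = \<epsilon> \<otimes> \<Delta>\<close> the counit law makes each factor \<open>\<sigma>\<^sub>i\<close> of the braided differential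
  undo the comultiplication made by \<open>\<sigma>\<^sub>i\<^sub>-\<^sub>1\<close> and perform the next one: if \<open>\<Delta> v = \<Sum> v' \<otimes> v''\<close>, then
  \<open>\<sigma>\<close> sends \<open>v'' \<otimes> w\<close> to \<open>\<epsilon>(v'') \<Delta>(w)\<close> and \<open>\<Sum> v' \<epsilon>(v'') = v\<close>. So, for a group-like \<open>e\<close>, moving \<open>e\<close> through
  \<open>v\<^sub>1 \<dots> v\<^sub>n\<close> with \<open>\<sigma>\<^sub>i \<circ> \<dots> \<circ> \<sigma>\<^sub>1\<close> leaves \<open>v\<^sub>1 \<dots> \<Delta>(v\<^sub>i) \<dots> v\<^sub>n\<close> (\<open>braiding_chain_eq\<close>), and the braided
  differential is \<open>x \<mapsto> e x + \<partial> x\<close>. Here \<open>\<partial>\<close> is the graded derivation of the tensor algebra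
  that extends \<open>-\<Delta>\<close>; \<open>\<partial>\<^sup>2 = 0\<close> is coassociativity (\<open>plin_codiff_square\<close>), and the remaining terms of the
  square of \<open>x \<mapsto> e x + \<partial> x\<close> cancel because \<open>\<Delta> e = e \<otimes> e\<close>.

  For the quotient, the projection \<open>V \<oplus> k\<one> \<rightarrow> V\<close> induces an algebra homomorphism of tensor algebras.
  Its kernel is the ideal generated by \<open>\<one>\<close>, as it is split by the map induced by the inclusion of \<open>V\<close>
  (\<open>tclass_in_ideal_one_iff\<close>). It kills \<open>\<one> x\<close> and carries \<open>\<Delta>\<close> to \<open>\<delta>\<close>, so it intertwines the braided
  differential with the derivation \<open>\<partial>\<close> of \<open>(V, \<delta>)\<close> (\<open>proj_braided_word\<close>). This one fact shows that the ideal is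
  stable and identifies the induced differential.

  All computations take place in the free algebra on words, whose elements represent tensors;
  an identity between tensors is an equality of \<open>tclass\<close>es. Linear maps out of the tensor
  algebra come from functions on words that are multilinear up to the tensor ideal
  (\<open>plin_cong_mod\<close>).
\<close>


section \<open>The free algebra on words\<close>

abbreviation word :: "'w list \<Rightarrow> 'w list \<Rightarrow>\<^sub>0 'k::field" where
  "word ws \<equiv> Poly_Mapping.single ws 1"

definition scal :: "'k::field \<Rightarrow> ('w list \<Rightarrow>\<^sub>0 'k) \<Rightarrow> 'w list \<Rightarrow>\<^sub>0 'k" where
  "scal c p = Poly_Mapping.single [] c * p"

lemma single_mult_single:
  "Poly_Mapping.single a c * Poly_Mapping.single b d = Poly_Mapping.single (a @ b) (c * d)"
  for c d :: "'k::field"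
  by (simp add: mult_single plus_list_def)

lemma scal_word: "scal c (word ws) = Poly_Mapping.single ws c"
  by (simp add: scal_def single_mult_single)

lemma word_append: "word (a @ b) = word a * word b"
  by (simp add: single_mult_single)

lemma word_Cons: "word (a # b) = gen a * word b"
  by (simp add: gen_def single_mult_single)

lemma word_Nil: "word [] = 1"
  by (metis single_one zero_list_def)

text \<open>
  Every element is a linear combination of words, so an identity that is linear in an element
  needs to be checked only on words.
\<close>

lemma words_induct [case_names word zero add scal]:
  fixes p :: "'w list \<Rightarrow>\<^sub>0 'k::field"
  assumes "\<And>ws. ws \<in> Poly_Mapping.keys p \<Longrightarrow> P (word ws)"
    and zero: "P 0"
    and "\<And>p q. P p \<Longrightarrow> P q \<Longrightarrow> P (p + q)"
    and "\<And>c p. P p \<Longrightarrow> P (scal c p)"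
  shows "P p"
proof -
  have "P (\<Sum>ws\<in>A. Poly_Mapping.single ws (Poly_Mapping.lookup p ws))"
    if "finite A" "A \<subseteq> Poly_Mapping.keys p" for A
    using that
  proof (induction A)
    case (insert a A)
    have "P (Poly_Mapping.single a (Poly_Mapping.lookup p a))"
      using assms(1)[of a] assms(4)[of "word a"] insert.prems by (simp add: scal_word)
    then show ?case
      using insert assms(3) by auto
  qed (simp add: zero)
  moreover have "(\<Sum>ws\<in>Poly_Mapping.keys p. Poly_Mapping.single ws (Poly_Mapping.lookup p ws)) = p"
    by (rule poly_mapping_eqI)
      (auto simp: lookup_sum lookup_single when_def in_keys_iff)
  ultimately show ?thesis
    by (metis finite_keys order_refl)
qed

lemma scal_add: "scal c (p + q) = scal c p + scal c q"
  by (simp add: scal_def distrib_left)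

lemma scal_zero: "scal c 0 = 0"
  by (simp add: scal_def)

lemma zero_scal: "scal 0 p = 0"
  by (simp add: scal_def)

lemma scal_minus: "scal c (- p) = - scal c p"
  by (simp add: scal_def)

lemma scal_diff: "scal c (p - q) = scal c p - scal c q"
  by (simp add: scal_def right_diff_distrib)

lemma scal_add_left: "scal (c + d) p = scal c p + scal d p"
  by (simp add: scal_def single_add distrib_right)

lemma scal_one: "scal 1 p = p"
  by (simp add: scal_def word_Nil)

lemma scal_scal: "scal c (scal d p) = scal (c * d) p"
  by (simp add: scal_def single_mult_single flip: mult.assoc)

lemma scal_commute: "scal c (scal d p) = scal d (scal c p)"
  by (simp add: scal_scal mult.commute)

lemma scal_minus_one: "scal (- 1) p = - p"
  by (metis scal_def scal_one mult_minus_left single_uminus)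

lemma scal_mult_left: "scal c p * q = scal c (p * q)"
  by (simp add: scal_def mult.assoc)

lemma scal_mult_right: "p * scal c q = scal c (p * q)"
proof -
  have "p * Poly_Mapping.single [] c = scal c p"
  proof (induction p rule: words_induct)
    case (scal d p)
    have "scal d p * Poly_Mapping.single [] c = scal d (scal c p)"
      by (simp add: scal_mult_left scal)
    then show ?case
      by (simp add: scal_commute)
  qed (simp_all add: scal_word single_mult_single scal_zero scal_add distrib_right)
  then show ?thesis
    by (simp add: scal_def flip: mult.assoc)
qed

lemmas scal_simps = scal_add scal_zero zero_scal scal_minus scal_diff scal_one scal_minus_one
  scal_mult_left scal_mult_right

definition homogeneous :: "nat \<Rightarrow> ('w list \<Rightarrow>\<^sub>0 'k::field) \<Rightarrow> bool" where
  "homogeneous n p \<longleftrightarrow> (\<forall>ws\<in>Poly_Mapping.keys p. length ws = n)"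

lemma homogeneous_induct [consumes 1, case_names word zero add scal]:
  assumes "homogeneous n p"
    and "\<And>ws. length ws = n \<Longrightarrow> P (word ws)"
    and "P 0"
    and "\<And>p q. P p \<Longrightarrow> P q \<Longrightarrow> P (p + q)"
    and "\<And>c p. P p \<Longrightarrow> P (scal c p)"
  shows "P p"
  using assms by (intro words_induct[of p P]) (auto simp: homogeneous_def)

lemma homogeneous_word [simp]: "homogeneous n (word ws) \<longleftrightarrow> length ws = n"
  by (simp add: homogeneous_def)

lemma homogeneous_zero [simp]: "homogeneous n 0"
  by (simp add: homogeneous_def)

lemma homogeneous_gen [simp]: "homogeneous (Suc 0) (gen w)"
  by (simp add: gen_def)

lemma homogeneous_add: "homogeneous n p \<Longrightarrow> homogeneous n q \<Longrightarrow> homogeneous n (p + q)"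
  using keys_add[of p q] by (auto simp: homogeneous_def)

lemma homogeneous_mult: "homogeneous m p \<Longrightarrow> homogeneous n q \<Longrightarrow> homogeneous (m + n) (p * q)"
  using keys_mult[of p q] by (force simp: homogeneous_def plus_list_def)

lemma homogeneous_scal: "homogeneous n p \<Longrightarrow> homogeneous n (scal c p)"
  using homogeneous_mult[of 0 "Poly_Mapping.single [] c" n p]
  by (simp add: scal_def homogeneous_def)

lemma homogeneous_uminus: "homogeneous n p \<Longrightarrow> homogeneous n (- p)"
  using homogeneous_scal[of n p "- 1"] by (simp add: scal_minus_one)

lemma homogeneous_diff: "homogeneous n p \<Longrightarrow> homogeneous n q \<Longrightarrow> homogeneous n (p - q)"
  using homogeneous_add[of n p "- q"] by (simp add: homogeneous_uminus)

text \<open>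
  The linear extension of a function on words; \<open>lin_ext\<close> is its counterpart on cosets.
\<close>

definition plin :: "('w list \<Rightarrow> 'u list \<Rightarrow>\<^sub>0 'k::field) \<Rightarrow> ('w list \<Rightarrow>\<^sub>0 'k) \<Rightarrow> 'u list \<Rightarrow>\<^sub>0 'k" where
  "plin G p = (\<Sum>ws\<in>Poly_Mapping.keys p. scal (Poly_Mapping.lookup p ws) (G ws))"

lemma plin_superset:
  assumes "finite A" "Poly_Mapping.keys p \<subseteq> A"
  shows "plin G p = (\<Sum>ws\<in>A. scal (Poly_Mapping.lookup p ws) (G ws))"
  unfolding plin_def using assms
  by (intro sum.mono_neutral_left) (auto simp: in_keys_iff zero_scal)

lemma plin_add: "plin G (p + q) = plin G p + plin G q"
  using keys_add[of p q]
  by (simp add: plin_superset[of "Poly_Mapping.keys p \<union> Poly_Mapping.keys q"] lookup_add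
      scal_add_left sum.distrib)

lemma plin_word: "plin G (word ws) = G ws"
  by (simp add: plin_def scal_one)

lemma lookup_scal: "Poly_Mapping.lookup (scal c p) ws = c * Poly_Mapping.lookup p ws"
  by (induction p arbitrary: c rule: words_induct)
    (simp_all add: scal_word scal_add scal_zero scal_scal lookup_add lookup_single when_def
      distrib_left)

lemma plin_scal: "plin G (scal c p) = scal c (plin G p)"
proof -
  have "plin G (scal c p)
      = (\<Sum>ws\<in>Poly_Mapping.keys p. scal (Poly_Mapping.lookup (scal c p) ws) (G ws))"
    by (rule plin_superset) (auto simp: in_keys_iff lookup_scal)
  also have "\<dots> = (\<Sum>ws\<in>Poly_Mapping.keys p. scal c (scal (Poly_Mapping.lookup p ws) (G ws)))"
    by (simp add: lookup_scal scal_scal)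
  also have "\<dots> = scal c (plin G p)"
    by (simp add: plin_def scal_def sum_distrib_left)
  finally show ?thesis .
qed

lemma plin_zero: "plin G 0 = 0"
  by (simp add: plin_def)

lemma plin_uminus: "plin G (- p) = - plin G p"
  by (metis plin_scal scal_minus_one)

lemma plin_diff: "plin G (p - q) = plin G p - plin G q"
  using plin_add[of G p "- q"] by (simp add: plin_uminus)

lemmas plin_simps = plin_add plin_zero plin_word plin_scal plin_uminus plin_diff

lemma plin_one: "plin G 1 = G []"
  by (simp add: plin_word flip: word_Nil)

lemma plin_gen: "plin G (gen w) = G [w]"
  by (simp add: plin_word gen_def)

lemma plin_homogeneous:
  assumes "homogeneous n p" "\<And>ws. length ws = n \<Longrightarrow> homogeneous m (G ws)"
  shows "homogeneous m (plin G p)"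
  using assms(1) by (induction rule: homogeneous_induct)
    (simp_all add: plin_simps assms(2) homogeneous_add homogeneous_scal)

text \<open>
  A representative-level version of \<open>tmap\<close>.
\<close>

definition word_map :: "('w \<Rightarrow> 'u) \<Rightarrow> ('w list \<Rightarrow>\<^sub>0 'k::field) \<Rightarrow> 'u list \<Rightarrow>\<^sub>0 'k" where
  "word_map f = plin (\<lambda>ws. word (map f ws))"

lemma word_map_simps:
  "word_map f (word ws) = word (map f ws)"
  "word_map f (gen w) = gen (f w)"
  "word_map f (p + q) = word_map f p + word_map f q"
  "word_map f (p - q) = word_map f p - word_map f q"
  "word_map f (- p) = - word_map f p"
  "word_map f 0 = 0"
  "word_map f 1 = 1"
  "word_map f (scal c p) = scal c (word_map f p)"
  by (simp_all add: word_map_def plin_simps plin_gen plin_one word_Nil) (simp add: gen_def)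

lemma word_map_mult: "word_map f (p * q) = word_map f p * word_map f q"
proof (induction p rule: words_induct)
  case (word a)
  show ?case
  proof (induction q rule: words_induct)
    case (word b)
    show ?case by (simp add: word_map_simps flip: word_append)
  qed (simp_all add: word_map_simps distrib_left scal_simps)
qed (simp_all add: word_map_simps distrib_right scal_simps)

lemma word_map_comp: "word_map f (word_map g p) = word_map (f \<circ> g) p"
  by (induction p rule: words_induct) (simp_all add: word_map_simps comp_def)

lemma word_map_id: "word_map (\<lambda>x. x) p = p"
  by (induction p rule: words_induct) (simp_all add: word_map_simps comp_def)

lemma homogeneous_word_map: "homogeneous n p \<Longrightarrow> homogeneous n (word_map f p)"
  unfolding word_map_def by (rule plin_homogeneous) simp_all


section \<open>The tensor algebra in terms of representatives\<close>

lemma free_algebra_simps [simp]: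
  "carrier free_algebra = UNIV"
  "p \<otimes>\<^bsub>free_algebra\<^esub> q = p * q"
  "p \<oplus>\<^bsub>free_algebra\<^esub> q = p + q"
  "\<one>\<^bsub>free_algebra\<^esub> = 1"
  "\<zero>\<^bsub>free_algebra\<^esub> = 0"
  by (simp_all add: free_algebra_def)

lemma ring_free_algebra: "ring free_algebra"
proof (rule ringI)
  show "abelian_group free_algebra"
    by (rule abelian_groupI) (auto simp: algebra_simps intro: exI[of _ "- x" for x])
  show "Group.monoid free_algebra"
    by (rule monoidI) (auto simp: algebra_simps)
qed (auto simp: algebra_simps)

lemma free_algebra_minus [simp]: "p \<ominus>\<^bsub>free_algebra\<^esub> q = p - q"
proof -
  interpret ring free_algebra by (rule ring_free_algebra)
  have "\<ominus>\<^bsub>free_algebra\<^esub> q = - q"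
    by (rule minus_equality) simp_all
  then show ?thesis
    by (simp add: a_minus_def)
qed

lemma ideal_tensor_ideal: "ideal (tensor_ideal s) free_algebra"
  unfolding tensor_ideal_def by (rule ring.genideal_ideal[OF ring_free_algebra]) simp

lemma ring_tensor_algebra: "ring (tensor_algebra s)"
  unfolding tensor_algebra_def by (rule ideal.quotient_is_ring[OF ideal_tensor_ideal])

lemma tclass_ring_hom: "tclass s \<in> ring_hom free_algebra (tensor_algebra s)"
  using ideal.rcos_ring_hom[OF ideal_tensor_ideal[of s]]
  by (simp add: tclass_def[abs_def] tensor_algebra_def)

lemma tclass_eq_iff: "tclass s p = tclass s q \<longleftrightarrow> p - q \<in> tensor_ideal s"
  using ring.quotient_eq_iff_same_a_r_cos[OF ring_free_algebra ideal_tensor_ideal, of p q s]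
  by (simp add: tclass_def)

lemma carrier_tensor_algebra: "carrier (tensor_algebra s) = range (tclass s)"
  unfolding tensor_algebra_def FactRing_simps tclass_def[abs_def] by auto

text \<open>
  These equations, used from left to right, move a computation in the tensor algebra to
  representatives.
\<close>

lemma tensor_algebra_simps:
  "tclass s p \<otimes>\<^bsub>tensor_algebra s\<^esub> tclass s q = tclass s (p * q)"
  "tclass s p \<oplus>\<^bsub>tensor_algebra s\<^esub> tclass s q = tclass s (p + q)"
  "\<one>\<^bsub>tensor_algebra s\<^esub> = tclass s 1"
  "\<zero>\<^bsub>tensor_algebra s\<^esub> = tclass s 0"
  "tclass s p \<in> carrier (tensor_algebra s)"
  "tscalar s c = tclass s (scal c 1)"
  "tscale s c (tclass s p) = tclass s (scal c p)"
  "pure s ws = tclass s (word ws)"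
proof -
  note hom = tclass_ring_hom[of s]
  show *: "tclass s p \<otimes>\<^bsub>tensor_algebra s\<^esub> tclass s q = tclass s (p * q)" for p q
    using ring_hom_mult[OF hom, of p q] by simp
  show "tclass s p \<oplus>\<^bsub>tensor_algebra s\<^esub> tclass s q = tclass s (p + q)"
    using ring_hom_add[OF hom, of p q] by simp
  show "\<one>\<^bsub>tensor_algebra s\<^esub> = tclass s 1"
    using ring_hom_one[OF hom] by simp
  show "\<zero>\<^bsub>tensor_algebra s\<^esub> = tclass s 0"
    using ring_hom_zero[OF hom ring_free_algebra ring_tensor_algebra] by simp
  show "tclass s p \<in> carrier (tensor_algebra s)"
    by (simp add: carrier_tensor_algebra)
  show **: "tscalar s c = tclass s (scal c 1)"
    by (simp add: tscalar_def scal_def)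
  show "tscale s c (tclass s p) = tclass s (scal c p)"
    by (simp add: tscale_def ** * scal_simps)
  show "pure s ws = tclass s (word ws)"
    by (simp add: pure_def)
qed

lemma tensor_algebra_minus: "tclass s p \<ominus>\<^bsub>tensor_algebra s\<^esub> tclass s q = tclass s (p - q)"
proof -
  interpret ring "tensor_algebra s" by (rule ring_tensor_algebra)
  have "\<ominus>\<^bsub>tensor_algebra s\<^esub> tclass s q = tclass s (- q)"
    by (rule minus_equality) (simp_all add: tensor_algebra_simps)
  then show ?thesis
    by (simp add: a_minus_def tensor_algebra_simps)
qed

lemma tclass_surj:
  assumes "x \<in> carrier (tensor_algebra s)"
  obtains p where "x = tclass s p"
  using assms by (auto simp: carrier_tensor_algebra)

lemma tpow_iff: "x \<in> tpow s n \<longleftrightarrow> (\<exists>p. homogeneous n p \<and> x = tclass s p)"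
  by (auto simp: tpow_def homogeneous_def)

lemma tclass_in_tpow: "homogeneous n p \<Longrightarrow> tclass s p \<in> tpow s n"
  by (auto simp: tpow_iff)

lemma finsum_tclass:
  assumes "finite A"
  shows "(\<Oplus>\<^bsub>tensor_algebra s\<^esub> i\<in>A. tclass s (f i)) = tclass s (\<Sum>i\<in>A. f i)"
proof -
  interpret ring "tensor_algebra s" by (rule ring_tensor_algebra)
  show ?thesis
    using assms by induction (simp_all add: tensor_algebra_simps Pi_def)
qed

lemma tclass_add_cong:
  assumes "tclass s p = tclass s p'" "tclass s q = tclass s q'"
  shows "tclass s (p + q) = tclass s (p' + q')"
  using assms by (metis tensor_algebra_simps(2))

lemma tclass_mult_cong:
  assumes "tclass s p = tclass s p'" "tclass s q = tclass s q'"
  shows "tclass s (p * q) = tclass s (p' * q')"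
  using assms by (metis tensor_algebra_simps(1))

lemma tclass_scal_cong:
  assumes "tclass s p = tclass s p'"
  shows "tclass s (scal c p) = tclass s (scal c p')"
  using assms by (metis tensor_algebra_simps(7))

lemma tclass_uminus_cong:
  assumes "tclass s p = tclass s p'"
  shows "tclass s (- p) = tclass s (- p')"
  using tclass_scal_cong[OF assms, of "- 1"] by (simp add: scal_minus_one)

lemma tclass_diff_cong:
  assumes "tclass s p = tclass s p'" "tclass s q = tclass s q'"
  shows "tclass s (p - q) = tclass s (p' - q')"
  using tclass_add_cong[OF assms(1) tclass_uminus_cong[OF assms(2)]] by simp

lemma tclass_eq_iff_diff: "tclass s p = tclass s q \<longleftrightarrow> tclass s (p - q) = tclass s 0"
  by (simp add: tclass_eq_iff)

text \<open>
  Linearity up to the tensor ideal of the target. A linear map into a tensor algebra has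
  such a map as a choice of representatives, which need not be linear on the nose.
\<close>

definition linear_mod ::
  "('k::field \<Rightarrow> 'w::ab_group_add \<Rightarrow> 'w) \<Rightarrow> ('k \<Rightarrow> 'u::ab_group_add \<Rightarrow> 'u) \<Rightarrow>
   ('w \<Rightarrow> 'u list \<Rightarrow>\<^sub>0 'k) \<Rightarrow> bool" where
  "linear_mod s t f \<longleftrightarrow>
     (\<forall>v w. tclass t (f (v + w)) = tclass t (f v + f w)) \<and>
     (\<forall>c v. tclass t (f (s c v)) = tclass t (scal c (f v)))"

definition multilinear_mod ::
  "('k::field \<Rightarrow> 'w::ab_group_add \<Rightarrow> 'w) \<Rightarrow> ('k \<Rightarrow> 'u::ab_group_add \<Rightarrow> 'u) \<Rightarrow>
   ('w list \<Rightarrow> 'u list \<Rightarrow>\<^sub>0 'k) \<Rightarrow> bool" where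
  "multilinear_mod s t G \<longleftrightarrow> (\<forall>a b. linear_mod s t (\<lambda>w. G (a @ w # b)))"

lemma linear_modI:
  assumes "\<And>v w. tclass t (f (v + w)) = tclass t (f v + f w)"
    and "\<And>c v. tclass t (f (s c v)) = tclass t (scal c (f v))"
  shows "linear_mod s t f"
  using assms by (simp add: linear_mod_def)

lemma linear_mod_add_eq: "linear_mod s t f \<Longrightarrow> tclass t (f (v + w)) = tclass t (f v + f w)"
  by (simp add: linear_mod_def)

lemma linear_mod_scale_eq: "linear_mod s t f \<Longrightarrow> tclass t (f (s c v)) = tclass t (scal c (f v))"
  by (simp add: linear_mod_def)

lemma linear_mod_at_zero:
  assumes "linear_mod s t f"
  shows "tclass t (f 0) = tclass t 0"
  using tclass_diff_cong[OF linear_mod_add_eq[OF assms, of 0 0] refl, of "f 0"] by simp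

lemma linear_mod_zero: "linear_mod s t (\<lambda>w. 0)"
  by (simp add: linear_mod_def scal_simps)

lemma linear_mod_add:
  assumes "linear_mod s t f" "linear_mod s t g"
  shows "linear_mod s t (\<lambda>w. f w + g w)"
proof (rule linear_modI)
  fix v w c
  show "tclass t (f (v + w) + g (v + w)) = tclass t (f v + g v + (f w + g w))"
    using tclass_add_cong[OF linear_mod_add_eq[OF assms(1)] linear_mod_add_eq[OF assms(2)]]
    by (simp add: ac_simps)
  show "tclass t (f (s c v) + g (s c v)) = tclass t (scal c (f v + g v))"
    using tclass_add_cong[OF linear_mod_scale_eq[OF assms(1)] linear_mod_scale_eq[OF assms(2)]]
    by (simp add: scal_simps)
qed

lemma linear_mod_mult_right:
  assumes "linear_mod s t f"
  shows "linear_mod s t (\<lambda>w. p * f w)"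
proof (rule linear_modI)
  fix v w c
  show "tclass t (p * f (v + w)) = tclass t (p * f v + p * f w)"
    using tclass_mult_cong[OF refl linear_mod_add_eq[OF assms]] by (simp add: distrib_left)
  show "tclass t (p * f (s c v)) = tclass t (scal c (p * f v))"
    using tclass_mult_cong[OF refl linear_mod_scale_eq[OF assms]] by (simp add: scal_simps)
qed

lemma linear_mod_mult_left:
  assumes "linear_mod s t f"
  shows "linear_mod s t (\<lambda>w. f w * p)"
proof (rule linear_modI)
  fix v w c
  show "tclass t (f (v + w) * p) = tclass t (f v * p + f w * p)"
    using tclass_mult_cong[OF linear_mod_add_eq[OF assms] refl] by (simp add: distrib_right)
  show "tclass t (f (s c v) * p) = tclass t (scal c (f v * p))"
    using tclass_mult_cong[OF linear_mod_scale_eq[OF assms] refl] by (simp add: scal_simps)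
qed

lemma linear_mod_scal: "linear_mod s t f \<Longrightarrow> linear_mod s t (\<lambda>w. scal c (f w))"
  unfolding scal_def by (rule linear_mod_mult_right)

lemma linear_mod_uminus: "linear_mod s t f \<Longrightarrow> linear_mod s t (\<lambda>w. - f w)"
  using linear_mod_scal[of s t f "- 1"] by (simp add: scal_minus_one)

lemma linear_mod_gen: "linear_mod s s gen"
proof (rule linear_modI)
  interpret ring free_algebra by (rule ring_free_algebra)
  have rel: "tensor_relations s \<subseteq> tensor_ideal s"
    unfolding tensor_ideal_def by (rule genideal_self) simp
  fix v w c
  have "gen (v + w) - gen v - gen w \<in> tensor_relations s"
    unfolding tensor_relations_def by blast
  with rel show "tclass s (gen (v + w)) = tclass s (gen v + gen w)"
    by (auto simp: tclass_eq_iff diff_diff_eq)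
  have "gen (s c v) - Poly_Mapping.single [] c * gen v \<in> tensor_relations s"
    unfolding tensor_relations_def by blast
  with rel show "tclass s (gen (s c v)) = tclass s (scal c (gen v))"
    by (auto simp: tclass_eq_iff scal_def)
qed

lemma linear_mod_gen_comp:
  assumes "\<And>v w. f (v + w) = f v + f w" "\<And>c v. f (s c v) = t c (f v)"
  shows "linear_mod s t (\<lambda>w. gen (f w))"
  using linear_mod_gen[of t] by (simp add: linear_mod_def assms)

lemma multilinear_mod_add:
  "multilinear_mod s t F \<Longrightarrow> multilinear_mod s t G \<Longrightarrow> multilinear_mod s t (\<lambda>ws. F ws + G ws)"
  by (simp add: multilinear_mod_def linear_mod_add)

lemma multilinear_mod_mult_right:
  "multilinear_mod s t G \<Longrightarrow> multilinear_mod s t (\<lambda>ws. p * G ws)"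
  by (simp add: multilinear_mod_def linear_mod_mult_right)

text \<open>
  A change in the first letter is seen by \<open>f\<close>, a change in a later letter by \<open>G\<close>. Hence functions
  defined by recursion on words are shown to be multilinear letter by letter.
\<close>

lemma multilinear_mod_Cons:
  assumes "linear_mod s t f" "multilinear_mod s t G"
    and "\<And>w ws. H (w # ws) = f w * G ws"
  shows "multilinear_mod s t H"
  unfolding multilinear_mod_def
proof (intro allI)
  fix a b
  show "linear_mod s t (\<lambda>w. H (a @ w # b))"
    using assms linear_mod_mult_left[OF assms(1), of "G b"]
    by (cases a) (auto simp: multilinear_mod_def intro: linear_mod_mult_right)
qed

lemma multilinear_mod_word_map:
  assumes "linear_mod s t (\<lambda>w. gen (f w))"
  shows "multilinear_mod s t (\<lambda>ws. word (map f ws))"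
  unfolding multilinear_mod_def
  by (auto simp: word_append word_Cons simp flip: mult.assoc
      intro!: linear_mod_mult_left linear_mod_mult_right assms)

lemma multilinear_mod_word: "multilinear_mod s s word"
  using multilinear_mod_word_map[of s s "\<lambda>w. w"] linear_mod_gen[of s] by simp

text \<open>
  The condition is linear in both outer factors, so words suffice for them.
\<close>

lemma plin_relation:
  assumes "\<And>u v. tclass t (plin G (word u * r * word v)) = tclass t 0"
  shows "tclass t (plin G (p * r * q)) = tclass t 0"
proof (induction p rule: words_induct)
  case (word u)
  show ?case
  proof (induction q rule: words_induct)
    case (add q q')
    then show ?case
      using tclass_add_cong[OF add] by (simp add: distrib_left plin_simps)
  next
    case (scal c q)
    then show ?case
      using tclass_scal_cong[OF scal] by (simp add: scal_simps plin_simps)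
  qed (simp_all add: assms plin_simps)
next
  case (add p p')
  then show ?case
    using tclass_add_cong[OF add] by (simp add: distrib_right plin_simps)
next
  case (scal c p)
  then show ?case
    using tclass_scal_cong[OF scal] by (simp add: scal_simps plin_simps)
qed (simp_all add: plin_simps)

text \<open>
  The universal property of the tensor algebra. The set of all \<open>p\<close> whose multiples \<open>u p v\<close> are sent to
  \<open>0\<close> is an ideal, and multilinearity says exactly that it contains the defining relations;
  hence it contains the whole tensor ideal.
\<close>

lemma plin_cong_mod:
  fixes G :: "'w::ab_group_add list \<Rightarrow> 'u::ab_group_add list \<Rightarrow>\<^sub>0 'k::field"
  assumes G: "multilinear_mod s t G" and eq: "tclass s p = tclass s q"
  shows "tclass t (plin G p) = tclass t (plin G q)"
proof -
  interpret ring "free_algebra :: ('w list \<Rightarrow>\<^sub>0 'k) ring" by (rule ring_free_algebra)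
  define K where "K = {p. \<forall>u v. tclass t (plin G (u * p * v)) = tclass t 0}"
  have "ideal K free_algebra"
  proof (rule idealI)
    show "subgroup K (add_monoid free_algebra)"
    proof (rule group.subgroupI)
      show "Group.group (add_monoid (free_algebra :: ('w list \<Rightarrow>\<^sub>0 'k) ring))"
        by (rule a_group)
      show "K \<noteq> {}"
        by (auto simp: K_def plin_simps intro!: exI[of _ 0])
      fix a assume a: "a \<in> K"
      have "inv\<^bsub>add_monoid free_algebra\<^esub> a = - a"
        using free_algebra_minus[of 0 a] by (simp add: a_minus_def a_inv_def del: free_algebra_minus)
      then show "inv\<^bsub>add_monoid free_algebra\<^esub> a \<in> K"
        using a tclass_uminus_cong[of t _ 0] by (auto simp: K_def plin_simps)
      fix b assume "b \<in> K"
      then show "a \<otimes>\<^bsub>add_monoid free_algebra\<^esub> b \<in> K"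
        using a tclass_add_cong[of t _ 0 _ 0]
        by (auto simp: K_def plin_simps distrib_left distrib_right)
    qed simp
    fix a x :: "'w list \<Rightarrow>\<^sub>0 'k" assume a: "a \<in> K"
    show "x \<otimes>\<^bsub>free_algebra\<^esub> a \<in> K" "a \<otimes>\<^bsub>free_algebra\<^esub> x \<in> K"
      using a by (auto simp: K_def mult.assoc) (metis mult.assoc)+
  qed (rule ring_free_algebra)
  moreover have "tensor_relations s \<subseteq> K"
  proof
    fix r assume "r \<in> tensor_relations s"
    then consider v w where "r = gen (v + w) - gen v - gen w"
      | c v where "r = gen (s c v) - scal c (gen v)"
      by (auto simp: tensor_relations_def scal_def)
    then have "tclass t (plin G (word a * r * word b)) = tclass t 0" for a b
    proof cases
      case 1
      have "plin G (word a * r * word b)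
          = G (a @ (v + w) # b) - (G (a @ v # b) + G (a @ w # b))"
        unfolding 1 gen_def
        by (simp add: plin_simps left_diff_distrib right_diff_distrib flip: word_append)
      moreover have "tclass t (G (a @ (v + w) # b)) = tclass t (G (a @ v # b) + G (a @ w # b))"
        using G by (simp add: multilinear_mod_def linear_mod_def)
      ultimately show ?thesis
        using tclass_eq_iff_diff by metis
    next
      case 2
      have "plin G (word a * r * word b) = G (a @ s c v # b) - scal c (G (a @ v # b))"
        unfolding 2 gen_def
        by (simp add: plin_simps left_diff_distrib right_diff_distrib scal_simps flip: word_append)
      moreover have "tclass t (G (a @ s c v # b)) = tclass t (scal c (G (a @ v # b)))"
        using G by (simp add: multilinear_mod_def linear_mod_def)
      ultimately show ?thesis
        using tclass_eq_iff_diff by metis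
    qed
    then have "tclass t (plin G (p * r * q)) = tclass t 0" for p q
      by (rule plin_relation)
    then show "r \<in> K"
      by (simp add: K_def)
  qed
  ultimately have "tensor_ideal s \<subseteq> K"
    unfolding tensor_ideal_def by (rule genideal_minimal)
  then have "p - q \<in> K"
    using eq by (auto simp: tclass_eq_iff)
  then have "tclass t (plin G (1 * (p - q) * 1)) = tclass t 0"
    unfolding K_def by blast
  then show ?thesis
    using tclass_eq_iff_diff[of t "plin G p"] by (simp add: plin_simps)
qed

lemma lin_ext_tclass:
  assumes G: "multilinear_mod s t G" and F: "\<And>ws. F ws = tclass t (G ws)"
  shows "lin_ext t F (tclass s p) = tclass t (plin G p)"
proof -
  have eq: "(\<lambda>p. \<Oplus>\<^bsub>tensor_algebra t\<^esub> ws\<in>Poly_Mapping.keys p.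
          tscale t (Poly_Mapping.lookup p ws) (F ws)) = (\<lambda>p. tclass t (plin G p))"
    by (simp add: F tensor_algebra_simps finsum_tclass plin_def)
  have rep: "tclass s q = tclass s p" if "q \<in> tclass s p" for q
  proof -
    have "q - p \<in> tensor_ideal s"
      using that by (auto simp: tclass_def a_r_coset_def')
    then show ?thesis
      by (simp add: tclass_eq_iff)
  qed
  have "0 \<in> tensor_ideal s"
    using additive_subgroup.zero_closed[OF ideal.axioms(1)[OF ideal_tensor_ideal[of s]]] by simp
  then have "p \<in> tclass s p"
    unfolding tclass_def a_r_coset_def' by (auto intro!: bexI[of _ 0])
  then have ne: "tclass s p \<noteq> {}"
    by blast
  show ?thesis
    unfolding lin_ext_def eq
    by (rule the_elem_image_unique[OF ne]) (rule plin_cong_mod[OF G rep])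
qed

lemma tmap_tclass:
  assumes "linear_mod s t (\<lambda>w. gen (f w))"
  shows "tmap t f (tclass s p) = tclass t (word_map f p)"
  unfolding tmap_def word_map_def
  by (rule lin_ext_tclass[OF multilinear_mod_word_map[OF assms]]) (simp add: tensor_algebra_simps)

lemma tmap_ring_hom:
  assumes "linear_mod s t (\<lambda>w. gen (f w))"
  shows "tmap t f \<in> ring_hom (tensor_algebra s) (tensor_algebra t)"
  by (rule ring_hom_memI)
    (auto simp: carrier_tensor_algebra tensor_algebra_simps tmap_tclass[OF assms]
      word_map_mult word_map_simps)

lemma word_map_cong_mod:
  assumes "linear_mod s t (\<lambda>w. gen (f w))" "tclass s p = tclass s q"
  shows "tclass t (word_map f p) = tclass t (word_map f q)"
  unfolding word_map_def by (rule plin_cong_mod[OF multilinear_mod_word_map[OF assms(1)] assms(2)])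

text \<open>
  \<open>f \<otimes> g\<close> in degree 2, with \<open>0\<close> in the other degrees as in \<open>tensor_maps\<close>.
\<close>

definition tens :: "('w \<Rightarrow> 'u list \<Rightarrow>\<^sub>0 'k::field) \<Rightarrow> ('w \<Rightarrow> 'u list \<Rightarrow>\<^sub>0 'k) \<Rightarrow>
    ('w list \<Rightarrow>\<^sub>0 'k) \<Rightarrow> 'u list \<Rightarrow>\<^sub>0 'k" where
  "tens f g = plin (\<lambda>ws. case ws of [v, w] \<Rightarrow> f v * g w | _ \<Rightarrow> 0)"

lemma tens_simps:
  "tens f g (word [v, w]) = f v * g w"
  "tens f g (p + q) = tens f g p + tens f g q"
  "tens f g (p - q) = tens f g p - tens f g q"
  "tens f g (- p) = - tens f g p"
  "tens f g 0 = 0"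
  "tens f g (scal c p) = scal c (tens f g p)"
  by (simp_all add: tens_def plin_simps)

lemma multilinear_mod_tens:
  assumes "linear_mod s t f" "linear_mod s t g"
  shows "multilinear_mod s t (\<lambda>ws. case ws of [v, w] \<Rightarrow> f v * g w | _ \<Rightarrow> 0)"
proof -
  have "multilinear_mod s t (\<lambda>ws. case ws of [w] \<Rightarrow> g w | _ \<Rightarrow> 0)"
    unfolding multilinear_mod_def
  proof (intro allI)
    fix a b :: "'b list"
    have "(case a @ w # b of [w] \<Rightarrow> g w | _ \<Rightarrow> 0) = (if a = [] \<and> b = [] then g w else 0)" for w
      by (cases a; cases b; cases "tl a") simp_all
    then show "linear_mod s t (\<lambda>w. case a @ w # b of [w] \<Rightarrow> g w | _ \<Rightarrow> 0)"
      using assms(2) by (cases "a = [] \<and> b = []") (simp_all add: linear_mod_zero)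
  qed
  then show ?thesis
    by (rule multilinear_mod_Cons[OF assms(1)]) (simp split: list.split)
qed

lemma tensor_maps_tclass:
  assumes "linear_mod s s f" "linear_mod s s g"
    and "\<And>v. F v = tclass s (f v)" "\<And>v. H v = tclass s (g v)"
  shows "tensor_maps s F H (tclass s p) = tclass s (tens f g p)"
  unfolding tensor_maps_def tens_def
  by (rule lin_ext_tclass[OF multilinear_mod_tens[OF assms(1,2)]])
    (simp add: assms(3,4) tensor_algebra_simps split: list.split)

lemma homogeneous_two_cases:
  assumes "length ws = 2"
  obtains v w where "ws = [v, w]"
  using assms by (auto simp: length_Suc_conv numeral_2_eq_2)


section \<open>The coderivation of a coassociative coalgebra\<close>

text \<open>
  The graded derivation \<open>\<partial>\<close> with \<open>\<partial> w = -D w\<close>, given on words by the Leibniz rule.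
\<close>

primrec codiff :: "('w \<Rightarrow> 'w list \<Rightarrow>\<^sub>0 'k::field) \<Rightarrow> 'w list \<Rightarrow> 'w list \<Rightarrow>\<^sub>0 'k" where
  "codiff D [] = 0"
| "codiff D (w # ws) = - (D w * word ws) - gen w * codiff D ws"

lemma codiff_eq_sum:
  "codiff D ws = (\<Sum>i\<in>{1..length ws}.
     scal ((-1) ^ i) (word (take (i - 1) ws) * D (ws ! (i - 1)) * word (drop i ws)))"
proof (induction ws)
  case (Cons w ws)
  let ?f = "\<lambda>ws i. scal ((-1) ^ i) (word (take (i - 1) ws) * D (ws ! (i - 1)) * word (drop i ws))"
  \<comment> \<open>Prepending a letter moves each comultiplication one place to the right, at the cost of a sign.\<close>
  have shift: "?f (w # ws) (Suc i) = - (gen w * ?f ws i)" if "i \<in> {1..length ws}" for i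
    using that scal_scal[of "-1" "(-1) ^ i", symmetric]
    by (cases i) (simp_all add: word_Cons scal_simps mult.assoc)
  have "(\<Sum>i\<in>{1..length (w # ws)}. ?f (w # ws) i)
      = ?f (w # ws) 1 + (\<Sum>i\<in>{1..length ws}. ?f (w # ws) (Suc i))"
    by (simp only: length_Cons One_nat_def sum.atLeast1_atMost_eq sum.lessThan_Suc_shift)
  also have "(\<Sum>i\<in>{1..length ws}. ?f (w # ws) (Suc i)) = - (gen w * codiff D ws)"
    unfolding Cons sum_distrib_left sum_negf[symmetric] by (rule sum.cong[OF refl shift])
  finally show ?case
    by (simp add: scal_simps word_Nil)
qed simp

lemma finsum_codiff:
  "(\<Oplus>\<^bsub>tensor_algebra s\<^esub> i\<in>{1..length ws}. tscale s ((-1) ^ i)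
      (pure s (take (i - 1) ws) \<otimes>\<^bsub>tensor_algebra s\<^esub> tclass s (D (ws ! (i - 1)))
        \<otimes>\<^bsub>tensor_algebra s\<^esub> pure s (drop i ws)))
   = tclass s (codiff D ws)"
  by (simp add: tensor_algebra_simps finsum_tclass codiff_eq_sum)

lemma homogeneous_codiff:
  assumes "\<And>v. homogeneous 2 (D v)"
  shows "homogeneous (Suc (length ws)) (codiff D ws)"
proof (induction ws)
  case (Cons w ws)
  show ?case
    using homogeneous_mult[OF assms[of w], of "length ws" "word ws"]
      homogeneous_mult[OF homogeneous_gen Cons, of w]
    by (simp add: homogeneous_diff homogeneous_uminus)
qed simp

lemma codiff_gen_mult: "plin (codiff D) (gen w * p) = - (D w * p) - gen w * plin (codiff D) p"
proof (induction p rule: words_induct)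
  case (word ws)
  show ?case by (simp add: plin_word flip: word_Cons)
next
  case (add p q)
  then show ?case by (simp add: plin_simps algebra_simps)
qed (simp_all add: plin_simps scal_simps)

text \<open>
  The graded Leibniz rule for a left factor of degree 2, where the sign of the second term
  is positive. The first term is \<open>\<partial> q\<close>.
\<close>

lemma codiff_square_mult:
  assumes "homogeneous 2 q"
  shows "plin (codiff D) (q * p) = (tens gen D q - tens D gen q) * p + q * plin (codiff D) p"
  using assms
proof (induction rule: homogeneous_induct)
  case (word ws)
  then obtain v w where ws: "ws = [v, w]"
    by (rule homogeneous_two_cases)
  have tens: "tens f g (word ws) = f v * g w" for f g :: "'a \<Rightarrow> 'a list \<Rightarrow>\<^sub>0 'b"
    by (simp add: ws tens_simps)
  have mult: "word ws * r = gen v * (gen w * r)" for r :: "'a list \<Rightarrow>\<^sub>0 'b"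
    by (simp add: ws word_Cons word_Nil mult.assoc)
  show ?case
    unfolding tens mult codiff_gen_mult by (simp add: algebra_simps)
next
  case (add p q)
  then show ?case by (simp add: plin_simps tens_simps algebra_simps)
qed (simp_all add: plin_simps tens_simps scal_simps flip: scal_diff)

lemma multilinear_mod_codiff:
  assumes "linear_mod s s D"
  shows "multilinear_mod s s (codiff D)"
  unfolding multilinear_mod_def
proof (intro allI)
  fix a b
  show "linear_mod s s (\<lambda>w. codiff D (a @ w # b))"
  proof (induction a)
    case Nil
    show ?case
      using linear_mod_add[OF linear_mod_uminus[OF linear_mod_mult_left[OF assms, of "word b"]]
          linear_mod_uminus[OF linear_mod_mult_left[OF linear_mod_gen, of s "codiff D b"]]]
      by simp
  next
    case (Cons v a)
    have "linear_mod s s (\<lambda>w. word (a @ w # b))"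
      using multilinear_mod_word[of s] by (simp add: multilinear_mod_def)
    from linear_mod_add[OF linear_mod_uminus[OF linear_mod_mult_right[OF this, of "D v"]]
        linear_mod_uminus[OF linear_mod_mult_right[OF Cons, of "gen v"]]]
    show ?case by simp
  qed
qed

text \<open>
  A map given on representatives is linear by construction, so only its degree and its
  square have to be examined.
\<close>

lemma tensor_differentialI:
  assumes f: "\<And>p. f (tclass s p) = tclass s (plin G p)"
    and deg: "\<And>ws. homogeneous (Suc (length ws)) (G ws)"
    and sq: "\<And>p. tclass s (plin G (plin G p)) = tclass s 0"
  shows "tensor_differential s f"
proof -
  have "tensor_linear_on s s (carrier (tensor_algebra s)) (carrier (tensor_algebra s)) f"
    by (auto simp: tensor_linear_on_def carrier_tensor_algebra tensor_algebra_simps f plin_simps)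
  moreover have "f ` tpow s n \<subseteq> tpow s (n + 1)" for n
  proof
    fix y assume "y \<in> f ` tpow s n"
    then obtain p where p: "homogeneous n p" "y = tclass s (plin G p)"
      by (auto simp: tpow_iff f)
    have "homogeneous (n + 1) (plin G p)"
      using p(1) deg by (intro plin_homogeneous[of n]) auto
    then show "y \<in> tpow s (n + 1)"
      using p(2) by (simp add: tclass_in_tpow)
  qed
  moreover have "f (f x) = \<zero>\<^bsub>tensor_algebra s\<^esub>" if "x \<in> carrier (tensor_algebra s)" for x
    using that by (auto simp: carrier_tensor_algebra f sq tensor_algebra_simps)
  ultimately show ?thesis
    by (simp add: tensor_differential_def)
qed

text \<open>
  A coassociative coalgebra with chosen representatives \<open>D v\<close> of the comultiplications. They
  are chosen homogeneous of degree 2, so that identities involving them can be checked on words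
  of two letters.
\<close>

locale coalgebra_reps =
  fixes s :: "'k::field \<Rightarrow> 'w::ab_group_add \<Rightarrow> 'w" and D :: "'w \<Rightarrow> 'w list \<Rightarrow>\<^sub>0 'k"
  assumes vector_space: "vector_space s"
    and linear_D: "linear_mod s s D"
    and homogeneous_D: "\<And>v. homogeneous 2 (D v)"
    and coassoc: "\<And>v. tclass s (tens D gen (D v)) = tclass s (tens gen D (D v))"
begin

text \<open>
  By the Leibniz rules, \<open>\<partial>\<^sup>2(w x) = (\<Sum> D(w') w'' - w' D(w'')) x + w \<partial>\<^sup>2 x\<close>: the terms
  \<open>D w \<partial> x\<close> occur with opposite signs, and the bracket vanishes by coassociativity.
\<close>

lemma plin_codiff_square: "tclass s (plin (codiff D) (plin (codiff D) p)) = tclass s 0"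
proof (induction p rule: words_induct)
  case (word ws)
  show ?case
  proof (induction ws)
    case (Cons w ws)
    have "plin (codiff D) (plin (codiff D) (word (w # ws)))
        = (tens D gen (D w) - tens gen D (D w)) * word ws
          + gen w * plin (codiff D) (plin (codiff D) (word ws))"
      by (simp add: plin_simps codiff_gen_mult codiff_square_mult[OF homogeneous_D] algebra_simps)
    moreover have "tclass s ((tens D gen (D w) - tens gen D (D w)) * word ws) = tclass s (0 * word ws)"
      by (intro tclass_mult_cong tclass_eq_iff_diff[THEN iffD1] coassoc refl)
    ultimately show ?case
      using tclass_add_cong[OF _ tclass_mult_cong[OF refl Cons]] by fastforce
  qed (simp add: plin_simps)
next
  case (add p q)
  then show ?case using tclass_add_cong[OF add] by (simp add: plin_simps)
next
  case (scal c p)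
  then show ?case using tclass_scal_cong[OF scal] by (simp add: plin_simps scal_simps)
qed (simp add: plin_simps)

lemma coassociative_coalgebra: "coassociative_coalgebra s (\<lambda>v. tclass s (D v))"
  unfolding coassociative_coalgebra_def linear_into_tpow_def
  using linear_D homogeneous_D coassoc
  by (auto simp: vector_space tensor_algebra_simps linear_mod_def gen_def
      tclass_in_tpow tensor_maps_tclass[OF linear_D linear_mod_gen] tensor_maps_tclass[OF linear_mod_gen linear_D])

end

lemma coalgebra_repsE:
  assumes "coassociative_coalgebra s \<delta>"
  obtains D where "coalgebra_reps s D" "\<delta> = (\<lambda>v. tclass s (D v))"
proof -
  from assms have vs: "vector_space s" and lin: "linear_into_tpow s 2 \<delta>"
    and coass: "\<And>v. tensor_maps s \<delta> (\<lambda>w. pure s [w]) (\<delta> v) = tensor_maps s (\<lambda>w. pure s [w]) \<delta> (\<delta> v)"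
    by (auto simp: coassociative_coalgebra_def)
  from lin have "\<forall>v. \<exists>p. homogeneous 2 p \<and> \<delta> v = tclass s p"
    by (simp add: linear_into_tpow_def tpow_iff)
  then obtain D where D: "\<And>v. homogeneous 2 (D v)" "\<And>v. \<delta> v = tclass s (D v)"
    by metis
  have linD: "linear_mod s s D"
    using lin by (simp add: linear_into_tpow_def D(2) tensor_algebra_simps linear_mod_def)
  have gen: "pure s [w] = tclass s (gen w)" for w
    by (simp add: gen_def tensor_algebra_simps)
  have "coalgebra_reps s D"
  proof (rule coalgebra_reps.intro)
    show "tclass s (tens D gen (D v)) = tclass s (tens gen D (D v))" for v
      using coass[of v] tensor_maps_tclass[OF linD linear_mod_gen D(2) gen, of "D v"]
        tensor_maps_tclass[OF linear_mod_gen linD gen D(2), of "D v"]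
      by (simp add: D(2))
  qed (rule vs linD D(1))+
  moreover have "\<delta> = (\<lambda>v. tclass s (D v))"
    using D(2) by (rule ext)
  ultimately show thesis
    by (rule that)
qed

section \<open>The braided differential of a group-like element\<close>

locale counital_reps = coalgebra_reps s D
  for s :: "'k::field \<Rightarrow> 'w::ab_group_add \<Rightarrow> 'w" and D :: "'w \<Rightarrow> 'w list \<Rightarrow>\<^sub>0 'k" +
  fixes \<epsilon> :: "'w \<Rightarrow> 'k"
  assumes counit_add: "\<epsilon> (v + w) = \<epsilon> v + \<epsilon> w"
    and counit_scale: "\<epsilon> (s c v) = c * \<epsilon> v"
    and counit_left: "tclass s (tens (\<lambda>w. scal (\<epsilon> w) 1) gen (D v)) = tclass s (gen v)"
    and counit_right: "tclass s (tens gen (\<lambda>w. scal (\<epsilon> w) 1) (D v)) = tclass s (gen v)"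
begin

lemma linear_counit: "linear_mod s s (\<lambda>w. scal (\<epsilon> w) p)"
  by (simp add: linear_mod_def counit_add counit_scale scal_add_left scal_scal)

lemma counital_coalgebra: "counital_coalgebra s (\<lambda>v. tclass s (D v)) \<epsilon>"
proof -
  interpret vs: vector_space s by (rule vector_space)
  interpret k: vector_space "(*) :: 'k \<Rightarrow> 'k \<Rightarrow> 'k"
    by unfold_locales (simp_all add: algebra_simps)
  have "Vector_Spaces.linear s (*) \<epsilon>"
    by unfold_locales (simp_all add: counit_add counit_scale)
  moreover have "tensor_maps s (\<lambda>w. tscalar s (\<epsilon> w)) (\<lambda>w. pure s [w]) (tclass s p)
      = tclass s (tens (\<lambda>w. scal (\<epsilon> w) 1) gen p)" for p
    by (rule tensor_maps_tclass[OF linear_counit linear_mod_gen])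
      (simp_all add: tensor_algebra_simps gen_def)
  moreover have "tensor_maps s (\<lambda>w. pure s [w]) (\<lambda>w. tscalar s (\<epsilon> w)) (tclass s p)
      = tclass s (tens gen (\<lambda>w. scal (\<epsilon> w) 1) p)" for p
    by (rule tensor_maps_tclass[OF linear_mod_gen linear_counit])
      (simp_all add: tensor_algebra_simps gen_def)
  ultimately show ?thesis
    using coassociative_coalgebra counit_left counit_right
    by (simp add: counital_coalgebra_def tensor_algebra_simps gen_def)
qed

abbreviation \<sigma> where "\<sigma> \<equiv> sigma_coAss s (\<lambda>v. tclass s (D v)) \<epsilon>"

lemma sigma_tclass: "\<sigma> (tclass s p) = tclass s (tens (\<lambda>v. scal (\<epsilon> v) 1) D p)"
  unfolding sigma_coAss_def
  by (rule tensor_maps_tclass[OF linear_counit linear_D]) (simp_all add: tensor_algebra_simps)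

text \<open>
  \<open>\<sigma>\<^sub>i\<close> on words. In the recursive form \<open>braid_simps\<close>, removing the first letter lowers \<open>i\<close> by one.
\<close>

definition braid :: "nat \<Rightarrow> 'w list \<Rightarrow> 'w list \<Rightarrow>\<^sub>0 'k" where
  "braid i ws = (if 1 \<le> i \<and> i < length ws
     then word (take (i - 1) ws) * scal (\<epsilon> (ws ! (i - 1))) (D (ws ! i)) * word (drop (i + 1) ws)
     else word ws)"

lemma braid_simps:
  "braid 0 ws = word ws"
  "braid i [] = word []"
  "braid (Suc 0) [v] = gen v"
  "braid (Suc 0) (v # w # ws) = scal (\<epsilon> v) (D w * word ws)"
  "braid (Suc (Suc i)) (v # ws) = gen v * braid (Suc i) ws"
  by (simp_all add: braid_def word_Nil scal_simps gen_def flip: mult.assoc word_Cons)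
    (simp_all add: word_Cons word_Nil scal_simps mult.assoc)

lemma multilinear_mod_braid: "multilinear_mod s s (braid i)"
proof (induction i rule: induct_nat_012)
  case 0
  show ?case
    using multilinear_mod_word[of s] by (simp add: braid_simps[abs_def] multilinear_mod_def)
next
  case 1
  have word: "linear_mod s s (\<lambda>w. word (a @ w # b))" for a b :: "'w list"
    using multilinear_mod_word[of s] by (simp add: multilinear_mod_def)
  have "linear_mod s s (\<lambda>w. braid (Suc 0) (a @ w # b))" for a b
  proof (cases a)
    case Nil
    then show ?thesis
      by (cases b) (simp_all add: braid_simps linear_mod_gen linear_counit)
  next
    case (Cons v a')
    then show ?thesis
      by (cases a') (simp_all add: braid_simps linear_mod_scal linear_mod_mult_left
          linear_mod_mult_right linear_D word)
  qed
  then show ?case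
    by (simp add: multilinear_mod_def)
next
  case (ge2 i)
  show ?case
    by (rule multilinear_mod_Cons[OF linear_mod_gen ge2(2)]) (rule braid_simps)
qed

lemma braiding_at_tclass: "braiding_at s \<sigma> i (tclass s p) = tclass s (plin (braid i) p)"
  unfolding braiding_at_def
  by (rule lin_ext_tclass[OF multilinear_mod_braid])
    (simp add: braid_def tensor_algebra_simps sigma_tclass tens_simps scal_simps)

lemma plin_braid_first:
  "homogeneous 2 q \<Longrightarrow> plin (braid 1) (gen v * q) = scal (\<epsilon> v) (tens D gen q)"
proof (induction rule: homogeneous_induct)
  case (word ws)
  then obtain x y where ws: "ws = [x, y]"
    by (rule homogeneous_two_cases)
  have word3: "gen v * word ws = word [v, x, y]"
    by (simp add: ws word_Cons)
  show ?case
    unfolding word3 by (simp add: plin_word braid_simps ws tens_simps gen_def)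
qed (simp_all add: plin_simps tens_simps distrib_left scal_simps scal_scal mult.commute)

lemma plin_braid_next:
  "homogeneous 2 q \<Longrightarrow> plin (braid (length a + 2)) (word a * q * word (w # b))
     = word a * tens gen (\<lambda>y. scal (\<epsilon> y) 1) q * D w * word b"
proof (induction rule: homogeneous_induct)
  case (word ws)
  then obtain x y where ws: "ws = [x, y]"
    by (rule homogeneous_two_cases)
  have "braid (length a + 2) (a @ x # y # w # b) = word a * (gen x * scal (\<epsilon> y) (D w * word b))"
    by (induction a) (simp_all add: braid_simps word_Nil word_Cons mult.assoc numeral_2_eq_2)
  then show ?case
    by (simp add: plin_word ws tens_simps scal_simps mult.assoc flip: word_append)
qed (simp_all add: plin_simps tens_simps distrib_left distrib_right scal_simps)

text \<open>
  The step of the braiding chain: by the counit law \<open>\<sigma>\<close> at the second tensor factor of \<open>D v\<close> and at \<open>w\<close>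
  turns \<open>D v \<otimes> w\<close> into \<open>v \<otimes> D w\<close>.
\<close>

lemma plin_braid_next_comult:
  "tclass s (plin (braid (length a + 2)) (word a * D v * word (w # b)))
     = tclass s (word a * gen v * D w * word b)"
  unfolding plin_braid_next[OF homogeneous_D]
  by (intro tclass_mult_cong refl counit_right)

lemma plin_braid_two_comult:
  "homogeneous 2 q \<Longrightarrow> tclass s (plin (braid 2) (tens D gen q)) = tclass s (tens gen D q)"
proof (induction rule: homogeneous_induct)
  case (word ws)
  then obtain x y where ws: "ws = [x, y]"
    by (rule homogeneous_two_cases)
  show ?case
    using plin_braid_next_comult[of "[]" x y "[]"] by (simp add: ws tens_simps word_Nil gen_def numeral_2_eq_2)
next
  case (add p q)
  then show ?case using tclass_add_cong[OF add(1,2)] by (simp add: plin_simps tens_simps)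
next
  case (scal c p)
  then show ?case using tclass_scal_cong[OF scal(1)] by (simp add: plin_simps tens_simps scal_simps)
qed (simp add: plin_simps tens_simps)

text \<open>
  On \<open>u v w\<close> both sides are \<open>\<epsilon>(u) \<epsilon>(v)\<close> times an iterated comultiplication of \<open>w\<close>: the left one
  is \<open>(\<Delta> \<otimes> id)(\<Delta> w)\<close>, and in the right one the last \<open>\<sigma>\<^sub>2\<close> turns \<open>(\<Delta> \<otimes> id)(\<Delta> w)\<close> into
  \<open>(id \<otimes> \<Delta>)(\<Delta> w)\<close>.
\<close>

lemma yang_baxter:
  assumes "homogeneous 3 p"
  shows "tclass s (plin (braid 1) (plin (braid 2) (plin (braid 1) p)))
       = tclass s (plin (braid 2) (plin (braid 1) (plin (braid 2) p)))"
  using assms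
proof (induction rule: homogeneous_induct)
  case (word ws)
  then obtain u v w where ws: "ws = [u, v, w]"
    by (auto simp: length_Suc_conv numeral_3_eq_3)
  let ?c = "\<epsilon> u * \<epsilon> v"
  have "plin (braid 2) (plin (braid 1) (word ws)) = scal (\<epsilon> u) (plin (braid 2) (D v * word [w]))"
    by (simp add: ws plin_simps braid_simps)
  moreover have "tclass s (plin (braid 2) (D v * word [w])) = tclass s (gen v * D w)"
    using plin_braid_next_comult[of "[]" v w "[]"] by (simp add: word_Nil numeral_2_eq_2)
  ultimately have "tclass s (plin (braid 2) (plin (braid 1) (word ws)))
      = tclass s (scal (\<epsilon> u) (gen v * D w))"
    by (metis tclass_scal_cong)
  from plin_cong_mod[OF multilinear_mod_braid this, of 1]
  have "tclass s (plin (braid 1) (plin (braid 2) (plin (braid 1) (word ws))))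
      = tclass s (scal ?c (tens D gen (D w)))"
    by (simp add: plin_simps plin_braid_first[OF homogeneous_D, simplified] scal_scal)
  also have "\<dots> = tclass s (scal ?c (tens gen D (D w)))"
    by (intro tclass_scal_cong coassoc)
  also have "\<dots> = tclass s (scal ?c (plin (braid 2) (tens D gen (D w))))"
    by (intro tclass_scal_cong plin_braid_two_comult[symmetric] homogeneous_D)
  also have "scal ?c (plin (braid 2) (tens D gen (D w)))
      = plin (braid 2) (plin (braid 1) (plin (braid 2) (word ws)))"
  proof -
    have "plin (braid 2) (word ws) = scal (\<epsilon> v) (gen u * D w)"
      by (simp add: ws plin_word braid_simps numeral_2_eq_2 scal_simps word_Nil)
    then show ?thesis
      by (simp add: plin_simps plin_braid_first[OF homogeneous_D, simplified] scal_scal mult.commute)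
  qed
  finally show ?case .
next
  case (add p q)
  then show ?case using tclass_add_cong[OF add(1,2)] by (simp add: plin_simps)
next
  case (scal c p)
  then show ?case using tclass_scal_cong[OF scal(1)] by (simp add: plin_simps)
qed (simp add: plin_simps)

lemma pre_braiding_sigma: "pre_braiding s \<sigma>"
proof -
  have hom: "homogeneous 2 (tens (\<lambda>v. scal (\<epsilon> v) 1) D p)" if "homogeneous 2 p" for p
    using that
  proof (induction rule: homogeneous_induct)
    case (word ws)
    then obtain x y where ws: "ws = [x, y]"
      by (rule homogeneous_two_cases)
    show ?case
      by (simp add: ws tens_simps scal_simps homogeneous_scal homogeneous_D)
  qed (simp_all add: tens_simps homogeneous_add homogeneous_scal)
  have "\<sigma> x \<in> tpow s 2" if "x \<in> tpow s 2" for x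
    using that tclass_in_tpow[OF hom] by (auto simp: tpow_iff[of x] sigma_tclass)
  then have "tensor_linear_on s s (tpow s 2) (tpow s 2) \<sigma>"
    unfolding tensor_linear_on_def
    by (simp add: image_subset_iff)
      (auto simp: tpow_iff tensor_algebra_simps sigma_tclass tens_simps)
  then show ?thesis
    unfolding pre_braiding_def
    by (auto simp: tpow_iff[of _ s 3] braiding_at_tclass yang_baxter[simplified])
qed

end

locale grouplike_reps = counital_reps s D \<epsilon>
  for s :: "'k::field \<Rightarrow> 'w::ab_group_add \<Rightarrow> 'w" and D :: "'w \<Rightarrow> 'w list \<Rightarrow>\<^sub>0 'k"
    and \<epsilon> :: "'w \<Rightarrow> 'k" +
  fixes e :: 'w
  assumes comult_e: "tclass s (D e) = tclass s (word [e, e])"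
    and counit_e: "\<epsilon> e = 1"
begin

lemma group_like: "group_like s (\<lambda>v. tclass s (D v)) \<epsilon> e"
  by (simp add: group_like_def comult_e counit_e tensor_algebra_simps)

lemma braided_cocharacter: "braided_cocharacter s \<sigma> e"
  by (simp add: braided_cocharacter_def tensor_algebra_simps sigma_tclass tens_simps scal_simps
      counit_e comult_e)

lemma braiding_chain_eq:
  "i \<le> length ws \<Longrightarrow> braiding_chain s \<sigma> i (tclass s (word (e # ws)))
     = tclass s (if i = 0 then word (e # ws)
         else word (take (i - 1) ws) * D (ws ! (i - 1)) * word (drop i ws))"
proof (induction i rule: induct_nat_012)
  case 1
  then obtain w r where ws: "ws = w # r"
    by (cases ws) auto
  show ?case
    by (simp add: ws braiding_at_tclass plin_word braid_simps counit_e scal_simps word_Nil)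
next
  case (ge2 j)
  let ?a = "take j ws"
  have drop: "drop (Suc j) ws = ws ! Suc j # drop (Suc (Suc j)) ws"
    using ge2.prems by (simp add: Cons_nth_drop_Suc)
  have "braiding_chain s \<sigma> (Suc (Suc j)) (tclass s (word (e # ws)))
      = braiding_at s \<sigma> (Suc (Suc j)) (tclass s (word ?a * D (ws ! j) * word (drop (Suc j) ws)))"
    using ge2 by simp
  also have "\<dots> = tclass s (word ?a * gen (ws ! j) * D (ws ! Suc j) * word (drop (Suc (Suc j)) ws))"
    using plin_braid_next_comult[of ?a "ws ! j" "ws ! Suc j" "drop (Suc (Suc j)) ws"] ge2.prems
    by (simp add: braiding_at_tclass drop min_def numeral_2_eq_2)
  also have "word ?a * gen (ws ! j) = (word (take (Suc j) ws) :: 'w list \<Rightarrow>\<^sub>0 'k)"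
    using ge2.prems by (simp add: take_Suc_conv_app_nth gen_def flip: word_append)
  finally show ?case
    by simp
qed simp

text \<open>
  The braided differential on words, in the form \<open>x \<mapsto> e x + \<partial> x\<close>.
\<close>

definition braided_word :: "'w list \<Rightarrow> 'w list \<Rightarrow>\<^sub>0 'k" where
  "braided_word ws = gen e * word ws + codiff D ws"

lemma left_braided_diff_deg_eq:
  "left_braided_diff_deg s \<sigma> e (length ws) (pure s ws) = tclass s (braided_word ws)"
proof -
  let ?f = "\<lambda>i. if i = 0 then word (e # ws)
         else word (take (i - 1) ws) * D (ws ! (i - 1)) * word (drop i ws)"
  have "left_braided_diff_deg s \<sigma> e (length ws) (pure s ws)
      = (\<Oplus>\<^bsub>tensor_algebra s\<^esub> i\<in>{0..length ws}. tclass s (scal ((-1) ^ i) (?f i)))"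
  proof -
    interpret ring "tensor_algebra s" by (rule ring_tensor_algebra)
    have "pure s [e] \<otimes>\<^bsub>tensor_algebra s\<^esub> pure s ws = tclass s (word (e # ws))"
      by (simp add: tensor_algebra_simps flip: word_append)
    then show ?thesis
      unfolding left_braided_diff_deg_def
      by (intro finsum_cong') (auto simp: braiding_chain_eq tensor_algebra_simps)
  qed
  also have "\<dots> = tclass s (\<Sum>i\<in>{0..length ws}. scal ((-1) ^ i) (?f i))"
    by (rule finsum_tclass) simp
  also have "(\<Sum>i\<in>{0..length ws}. scal ((-1) ^ i) (?f i)) = braided_word ws"
    by (simp add: sum.atLeast_Suc_atMost scal_simps braided_word_def codiff_eq_sum word_Cons)
  finally show ?thesis .
qed

lemma left_braided_diff_tclass: "left_braided_diff s \<sigma> e (tclass s p) = tclass s (plin braided_word p)"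
proof -
  have "multilinear_mod s s braided_word"
    unfolding braided_word_def
    by (intro multilinear_mod_add multilinear_mod_mult_right multilinear_mod_word
        multilinear_mod_codiff linear_D)
  then show ?thesis
    unfolding left_braided_diff_def
    by (rule lin_ext_tclass) (rule left_braided_diff_deg_eq)
qed

lemma plin_braided_word: "plin braided_word p = gen e * p + plin (codiff D) p"
  by (induction p rule: words_induct)
    (simp_all add: plin_simps braided_word_def algebra_simps scal_simps)

text \<open>
  In \<open>e (e x + \<partial> x) + \<partial>(e x + \<partial> x)\<close> the Leibniz rule gives \<open>\<partial>(e x) = -D(e) x - e \<partial> x\<close>, which leaves
  \<open>(e e - D e) x + \<partial>\<^sup>2 x\<close>.
\<close>

lemma plin_braided_word_square: "tclass s (plin braided_word (plin braided_word p)) = tclass s 0"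
proof -
  have "plin braided_word (plin braided_word p)
      = (word [e, e] - D e) * p + plin (codiff D) (plin (codiff D) p)"
    by (simp add: plin_braided_word plin_simps codiff_gen_mult word_Cons word_Nil algebra_simps)
  moreover have "tclass s ((word [e, e] - D e) * p) = tclass s (0 * p)"
    by (intro tclass_mult_cong tclass_eq_iff_diff[THEN iffD1] comult_e[symmetric] refl)
  ultimately show ?thesis
    using tclass_add_cong[OF _ plin_codiff_square] by fastforce
qed

lemma tensor_differential_left_braided_diff: "tensor_differential s (left_braided_diff s \<sigma> e)"
proof (rule tensor_differentialI[OF left_braided_diff_tclass _ plin_braided_word_square])
  show "homogeneous (Suc (length ws)) (braided_word ws)" for ws
    using homogeneous_codiff[of D ws, OF homogeneous_D]
    by (simp add: braided_word_def homogeneous_add flip: word_Cons)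
qed

end


section \<open>The counital extension\<close>

lemma ext_scale_simps [simp]:
  "fst (ext_scale s c x) = s c (fst x)" "snd (ext_scale s c x) = c * snd x"
  by (simp_all add: ext_scale_def)

lemma ext_one_simps [simp]: "fst ext_one = 0" "snd ext_one = 1"
  by (simp_all add: ext_one_def)

lemma ext_incl_simps [simp]: "fst (ext_incl v) = v" "snd (ext_incl v) = 0"
  by (simp_all add: ext_incl_def)

lemma ext_decompose:
  assumes "vector_space s"
  shows "x = ext_incl (fst x) + ext_scale s (snd x) ext_one"
proof -
  interpret vector_space s by fact
  show ?thesis
    by (simp add: prod_eq_iff)
qed

lemma vector_space_ext_scale:
  assumes "vector_space s"
  shows "vector_space (ext_scale s)"
proof -
  interpret vector_space s by fact
  show ?thesis
    by unfold_locales (simp_all add: prod_eq_iff algebra_simps)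
qed

lemma linear_mod_ext_incl:
  assumes "vector_space s"
  shows "linear_mod s (ext_scale s) (\<lambda>v. gen (ext_incl v))"
proof -
  interpret vector_space s by fact
  show ?thesis
    by (rule linear_mod_gen_comp) (simp_all add: prod_eq_iff)
qed

lemma linear_mod_fst: "linear_mod (ext_scale s) s (\<lambda>x. gen (fst x))"
  by (rule linear_mod_gen_comp) simp_all

lemma quot_to_V_proj [simp]: "quot_to_V (quot_proj x) = fst x"
  by transfer simp

lemma quot_proj_incl_to_V [simp]: "quot_proj (ext_incl (quot_to_V x)) = x"
  by transfer (simp only: diff_in_one_line_iff ext_incl_simps)

lemma quot_proj_incl_fst [simp]: "quot_proj (ext_incl (fst x)) = quot_proj x"
  by transfer (simp only: diff_in_one_line_iff ext_incl_simps)

lemma linear_mod_quot_proj: "linear_mod (ext_scale s) (quot_scale s) (\<lambda>x. gen (quot_proj x))"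
  by (rule linear_mod_gen_comp) (transfer, simp only: diff_in_one_line_iff)+

lemma linear_mod_quot_to_V: "linear_mod (quot_scale s) s (\<lambda>x. gen (quot_to_V x))"
  by (rule linear_mod_gen_comp) (transfer, simp)+

lemma linear_mod_quot_proj_incl:
  assumes "vector_space s"
  shows "linear_mod s (quot_scale s) (\<lambda>v. gen (quot_proj (ext_incl v)))"
proof -
  interpret vector_space s by fact
  show ?thesis
    by (rule linear_mod_gen_comp) (transfer, simp only: diff_in_one_line_iff, simp)+
qed

context coalgebra_reps
begin

abbreviation W where "W \<equiv> ext_scale s"

abbreviation one :: "'w \<times> 'k" where "one \<equiv> ext_one"

abbreviation incl :: "('w list \<Rightarrow>\<^sub>0 'k) \<Rightarrow> ('w \<times> 'k) list \<Rightarrow>\<^sub>0 'k" where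
  "incl \<equiv> word_map ext_incl"

definition ext_D :: "'w \<times> 'k \<Rightarrow> ('w \<times> 'k) list \<Rightarrow>\<^sub>0 'k" where
  "ext_D x = incl (D (fst x)) + gen one * gen (ext_incl (fst x)) + gen (ext_incl (fst x)) * gen one
     + scal (snd x) (gen one * gen one)"

lemma incl_cong_mod: "tclass s p = tclass s q \<Longrightarrow> tclass W (incl p) = tclass W (incl q)"
  by (rule word_map_cong_mod[OF linear_mod_ext_incl[OF vector_space]])

lemma ext_comult_eq: "ext_comult s (\<lambda>v. tclass s (D v)) = (\<lambda>x. tclass W (ext_D x))"
  by (simp add: fun_eq_iff ext_comult_def Let_def tensor_algebra_simps
      tmap_tclass[OF linear_mod_ext_incl[OF vector_space]] ext_D_def word_Cons word_Nil)

lemma linear_ext_D: "linear_mod W W ext_D"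
proof -
  have "linear_mod W W (\<lambda>x. incl (D (fst x)))"
  proof (rule linear_modI)
    fix x y :: "'w \<times> 'k" and c
    show "tclass W (incl (D (fst (x + y)))) = tclass W (incl (D (fst x)) + incl (D (fst y)))"
      using incl_cong_mod[OF linear_mod_add_eq[OF linear_D]] by (simp add: word_map_simps)
    show "tclass W (incl (D (fst (W c x)))) = tclass W (scal c (incl (D (fst x))))"
      using incl_cong_mod[OF linear_mod_scale_eq[OF linear_D]] by (simp add: word_map_simps)
  qed
  moreover have "linear_mod W W (\<lambda>x. gen (ext_incl (fst x)))"
    by (rule linear_mod_gen_comp) (simp_all add: prod_eq_iff)
  moreover have "linear_mod W W (\<lambda>x. scal (snd x) (gen one * gen one))"
    by (simp add: linear_mod_def scal_add_left scal_scal)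
  ultimately show ?thesis
    unfolding ext_D_def by (intro linear_mod_add linear_mod_mult_left linear_mod_mult_right)
qed

lemma ext_D_incl:
  "ext_D (ext_incl v) = incl (D v) + gen one * gen (ext_incl v) + gen (ext_incl v) * gen one"
  by (simp add: ext_D_def scal_simps)

lemma ext_D_one: "tclass W (ext_D one) = tclass W (gen one * gen one)"
proof -
  \<comment> \<open>The representatives at \<open>0\<close> lie in the tensor ideal but need not vanish.\<close>
  have incl0: "tclass W (gen (ext_incl (0::'w))) = tclass W 0"
    by (rule linear_mod_at_zero[OF linear_mod_ext_incl[OF vector_space]])
  have "tclass W (incl (D 0)) = tclass W 0"
    using incl_cong_mod[OF linear_mod_at_zero[OF linear_D]] by (simp add: word_map_simps)
  then have "tclass W (ext_D one) = tclass W (0 + gen one * 0 + 0 * gen one + gen one * gen one)"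
    unfolding ext_D_def by (intro tclass_add_cong tclass_mult_cong)
      (simp_all add: incl0 scal_simps)
  then show ?thesis by simp
qed

lemma homogeneous_ext_D: "homogeneous 2 (ext_D x)"
proof -
  have "homogeneous 2 (gen v * gen w)" for v w :: "'w \<times> 'k"
    using homogeneous_mult[OF homogeneous_gen homogeneous_gen, of v w] by (simp add: numeral_2_eq_2)
  then show ?thesis
    unfolding ext_D_def
    by (intro homogeneous_add homogeneous_scal homogeneous_word_map homogeneous_D)
qed

text \<open>
  \<open>v w \<mapsto> v \<one> w\<close>, which appears on both sides of coassociativity of the extension.
\<close>

abbreviation insert_one :: "('w list \<Rightarrow>\<^sub>0 'k) \<Rightarrow> ('w \<times> 'k) list \<Rightarrow>\<^sub>0 'k" where
  "insert_one \<equiv> tens (\<lambda>v. gen (ext_incl v) * gen one) (\<lambda>w. gen (ext_incl w))"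

lemma tens_ext_D_gen:
  "homogeneous 2 q \<Longrightarrow> tens ext_D gen (incl q)
     = incl (tens D gen q) + gen one * incl q + insert_one q"
proof (induction rule: homogeneous_induct)
  case (word ws)
  then obtain x y where ws: "ws = [x, y]"
    by (rule homogeneous_two_cases)
  show ?case
    by (simp add: ws word_map_simps tens_simps word_map_mult ext_D_incl)
      (simp add: word_Cons word_Nil algebra_simps)
next
  case (add p q)
  then show ?case by (simp add: word_map_simps tens_simps algebra_simps)
qed (simp_all add: word_map_simps tens_simps scal_simps)

lemma tens_gen_ext_D:
  "homogeneous 2 q \<Longrightarrow> tens gen ext_D (incl q)
     = incl (tens gen D q) + insert_one q + incl q * gen one"
proof (induction rule: homogeneous_induct)
  case (word ws)
  then obtain x y where ws: "ws = [x, y]"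
    by (rule homogeneous_two_cases)
  show ?case
    by (simp add: ws word_map_simps tens_simps word_map_mult ext_D_incl)
      (simp add: word_Cons word_Nil algebra_simps)
next
  case (add p q)
  then show ?case by (simp add: word_map_simps tens_simps algebra_simps)
qed (simp_all add: word_map_simps tens_simps scal_simps)

lemma tens_ext_D:
  "tens f g (ext_D x) = tens f g (incl (D (fst x))) + f one * g (ext_incl (fst x))
     + f (ext_incl (fst x)) * g one + scal (snd x) (f one * g one)"
proof -
  have "tens f g (gen v * gen w) = f v * g w" for v w
    using tens_simps(1)[of f g v w] by (simp add: word_Cons word_Nil)
  then show ?thesis
    by (simp add: ext_D_def tens_simps)
qed

text \<open>
  With \<open>v\<close> in \<open>V\<close>, both sides expand to the sum of the twofold comultiplication of \<open>v\<close> in \<open>V\<close>, of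
  \<open>\<delta>(v)\<close> with one \<open>\<one>\<close> inserted at each of the three places, and of \<open>v\<close> with two \<open>\<one>\<close>s; they differ only by
  coassociativity of \<open>\<delta>\<close>.
\<close>

lemma ext_coassoc: "tclass W (tens ext_D gen (ext_D x)) = tclass W (tens gen ext_D (ext_D x))"
proof -
  let ?v = "fst x" and ?c = "snd x" and ?g = "gen one :: ('w \<times> 'k) list \<Rightarrow>\<^sub>0 'k"
  let ?i = "gen (ext_incl ?v) :: ('w \<times> 'k) list \<Rightarrow>\<^sub>0 'k"
  have "tens ext_D gen (ext_D x) = incl (tens D gen (D ?v)) + ?g * incl (D ?v) + insert_one (D ?v)
      + ext_D one * ?i + ext_D (ext_incl ?v) * ?g + scal ?c (ext_D one * ?g)"
    by (simp add: tens_ext_D[of ext_D] tens_ext_D_gen homogeneous_D)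
  also have "tclass W \<dots> = tclass W (incl (tens gen D (D ?v)) + ?g * incl (D ?v) + insert_one (D ?v)
      + (?g * ?g) * ?i + ext_D (ext_incl ?v) * ?g + scal ?c ((?g * ?g) * ?g))"
    by (intro tclass_add_cong tclass_mult_cong tclass_scal_cong refl ext_D_one incl_cong_mod coassoc)
  also have "incl (tens gen D (D ?v)) + ?g * incl (D ?v) + insert_one (D ?v)
      + (?g * ?g) * ?i + ext_D (ext_incl ?v) * ?g + scal ?c ((?g * ?g) * ?g)
    = incl (tens gen D (D ?v)) + insert_one (D ?v) + incl (D ?v) * ?g
      + ?g * ext_D (ext_incl ?v) + ?i * (?g * ?g) + scal ?c (?g * (?g * ?g))"
    by (simp add: ext_D_incl algebra_simps)
  also have "tclass W \<dots> = tclass W (incl (tens gen D (D ?v)) + insert_one (D ?v) + incl (D ?v) * ?g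
      + ?g * ext_D (ext_incl ?v) + ?i * ext_D one + scal ?c (?g * ext_D one))"
    by (intro tclass_add_cong tclass_mult_cong tclass_scal_cong refl ext_D_one[symmetric])
  also have "incl (tens gen D (D ?v)) + insert_one (D ?v) + incl (D ?v) * ?g
      + ?g * ext_D (ext_incl ?v) + ?i * ext_D one + scal ?c (?g * ext_D one)
    = tens gen ext_D (ext_D x)"
    by (simp add: tens_ext_D[of gen] tens_gen_ext_D homogeneous_D)
  finally show ?thesis .
qed

lemma tens_counit_incl:
  "homogeneous 2 q \<Longrightarrow> tens (\<lambda>w. scal (ext_counit w) 1) gen (incl q) = 0
     \<and> tens gen (\<lambda>w. scal (ext_counit w) 1) (incl q) = 0"
proof (induction rule: homogeneous_induct)
  case (word ws)
  then obtain x y where "ws = [x, y]"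
    by (rule homogeneous_two_cases)
  then show ?case
    by (simp add: word_map_simps tens_simps ext_counit_def scal_simps)
qed (simp_all add: word_map_simps tens_simps scal_simps)

lemma gen_decompose: "tclass W (gen x) = tclass W (gen (ext_incl (fst x)) + scal (snd x) (gen one))"
proof -
  have "tclass W (gen x) = tclass W (gen (ext_incl (fst x) + W (snd x) one))"
    using ext_decompose[OF vector_space, of x] by simp
  also have "\<dots> = tclass W (gen (ext_incl (fst x)) + gen (W (snd x) one))"
    by (rule linear_mod_add_eq[OF linear_mod_gen])
  also have "\<dots> = tclass W (gen (ext_incl (fst x)) + scal (snd x) (gen one))"
    by (intro tclass_add_cong refl linear_mod_scale_eq[OF linear_mod_gen])
  finally show ?thesis .
qed

lemma grouplike_ext: "grouplike_reps W ext_D ext_counit one"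
proof (intro grouplike_reps.intro counital_reps.intro coalgebra_reps.intro
    counital_reps_axioms.intro grouplike_reps_axioms.intro)
  fix x :: "'w \<times> 'k"
  have "tens (\<lambda>w. scal (ext_counit w) 1) gen (ext_D x) = gen (ext_incl (fst x)) + scal (snd x) (gen one)"
    by (simp add: tens_ext_D tens_counit_incl homogeneous_D) (simp add: ext_counit_def scal_simps)
  then show "tclass W (tens (\<lambda>w. scal (ext_counit w) 1) gen (ext_D x)) = tclass W (gen x)"
    using gen_decompose by metis
  have "tens gen (\<lambda>w. scal (ext_counit w) 1) (ext_D x) = gen (ext_incl (fst x)) + scal (snd x) (gen one)"
    by (simp add: tens_ext_D tens_counit_incl homogeneous_D) (simp add: ext_counit_def scal_simps)
  then show "tclass W (tens gen (\<lambda>w. scal (ext_counit w) 1) (ext_D x)) = tclass W (gen x)"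
    using gen_decompose by metis
qed (use ext_D_one linear_ext_D homogeneous_ext_D ext_coassoc vector_space_ext_scale[OF vector_space]
      in \<open>simp_all add: ext_counit_def word_Cons word_Nil\<close>)

end


section \<open>The ideal generated by the group-like element\<close>

text \<open>
  The form in which \<open>induced_map\<close> and \<open>induced_endo\<close> are evaluated.
\<close>

lemma (in ideal) the_elem_image_coset:
  assumes "x \<in> carrier R"
    and "\<And>y. y \<in> carrier R \<Longrightarrow> I +> y = I +> x \<Longrightarrow> f y = f x"
  shows "the_elem (f ` (I +> x)) = f x"
proof (rule the_elem_image_unique)
  show "I +> x \<noteq> {}"
    using a_rcos_self[OF assms(1)] by blast
  fix y assume y: "y \<in> I +> x"
  have "y \<in> carrier R"
    using y a_r_coset_subset_G[OF a_subset assms(1)] by blast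
  moreover have "I +> y = I +> x"
    using a_repr_independence[OF y assms(1) a_subgroup] by simp
  ultimately show "f y = f x"
    by (rule assms(2))
qed

text \<open>
  A copy of \<open>coalgebra_reps\<close> that carries the facts about the extension. As the extension is itself
  an instance of \<open>coalgebra_reps\<close>, attaching them there would iterate the extension without end.
\<close>

locale coalgebra_extension = coalgebra_reps s D
  for s :: "'k::field \<Rightarrow> 'w::ab_group_add \<Rightarrow> 'w" and D :: "'w \<Rightarrow> 'w list \<Rightarrow>\<^sub>0 'k"

sublocale coalgebra_extension \<subseteq> ext: grouplike_reps "ext_scale s" ext_D ext_counit ext_one
  by (rule grouplike_ext)

context coalgebra_extension
begin

abbreviation I where "I \<equiv> ideal_one s"

abbreviation TW where "TW \<equiv> tensor_algebra W"

abbreviation proj :: "(('w \<times> 'k) list \<Rightarrow>\<^sub>0 'k) \<Rightarrow> 'w list \<Rightarrow>\<^sub>0 'k" where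
  "proj \<equiv> word_map fst"

lemma ideal_ideal_one: "ideal I TW"
  unfolding ideal_one_def
  by (rule ring.genideal_ideal[OF ring_tensor_algebra]) (simp add: tensor_algebra_simps)

lemma ideal_one_closed:
  "tclass W p \<in> I \<Longrightarrow> tclass W q \<in> I \<Longrightarrow> tclass W (p + q) \<in> I"
  "tclass W p \<in> I \<Longrightarrow> tclass W (r * p) \<in> I"
  "tclass W p \<in> I \<Longrightarrow> tclass W (p * r) \<in> I"
  "tclass W p \<in> I \<Longrightarrow> tclass W (scal c p) \<in> I"
  "tclass W 0 \<in> I"
  "tclass W (gen one) \<in> I"
proof -
  interpret ideal I TW by (rule ideal_ideal_one)
  show "tclass W p \<in> I \<Longrightarrow> tclass W q \<in> I \<Longrightarrow> tclass W (p + q) \<in> I"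
    using a_closed by (simp flip: tensor_algebra_simps(2))
  show l: "tclass W p \<in> I \<Longrightarrow> tclass W (r * p) \<in> I" for r
    using I_l_closed[OF _ tensor_algebra_simps(5)] by (simp flip: tensor_algebra_simps(1))
  show "tclass W p \<in> I \<Longrightarrow> tclass W (p * r) \<in> I"
    using I_r_closed[OF _ tensor_algebra_simps(5)] by (simp flip: tensor_algebra_simps(1))
  show "tclass W p \<in> I \<Longrightarrow> tclass W (scal c p) \<in> I"
    unfolding scal_def by (rule l)
  show "tclass W 0 \<in> I"
    using zero_closed by (simp flip: tensor_algebra_simps(4))
  show "tclass W (gen one) \<in> I"
    using ring.genideal_self'[OF ring_tensor_algebra tensor_algebra_simps(5)[of W "gen one"]]
    by (simp add: ideal_one_def tensor_algebra_simps gen_def)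
qed

text \<open>
  Modulo the ideal, each letter \<open>v + c\<one>\<close> may be replaced by \<open>v\<close>.
\<close>

lemma word_diff_in_ideal_one: "tclass W (word ws - incl (proj (word ws))) \<in> I"
proof (induction ws)
  case (Cons w ws)
  let ?w' = "gen (ext_incl (fst w)) :: ('w \<times> 'k) list \<Rightarrow>\<^sub>0 'k"
  have eq: "word (w # ws) - incl (proj (word (w # ws)))
      = (gen w - ?w') * word ws + ?w' * (word ws - incl (proj (word ws)))"
    by (simp add: word_map_simps word_map_mult word_Cons algebra_simps)
  have "tclass W (gen w - ?w') = tclass W (scal (snd w) (gen one))"
    using tclass_diff_cong[OF gen_decompose refl, of w ?w'] by simp
  then have "tclass W (gen w - ?w') \<in> I"
    by (simp add: ideal_one_closed)
  then show ?case
    unfolding eq by (intro ideal_one_closed Cons)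
qed (simp add: word_map_simps ideal_one_closed)

lemma diff_in_ideal_one: "tclass W (p - incl (proj p)) \<in> I"
proof (induction p rule: words_induct)
  case (word ws)
  show ?case by (rule word_diff_in_ideal_one)
next
  case (add p q)
  then show ?case using ideal_one_closed(1)[OF add] by (simp add: word_map_simps algebra_simps)
next
  case (scal c p)
  then show ?case using ideal_one_closed(4)[OF scal, of c] by (simp add: word_map_simps scal_simps)
qed (simp add: word_map_simps ideal_one_closed)

text \<open>
  The ideal is the kernel of the algebra homomorphism induced by the projection to \<open>V\<close>. The
  kernel is an ideal containing \<open>\<one>\<close>; conversely \<open>p\<close> differs from the image of its projection
  under the inclusion by an element of the ideal.
\<close>

lemma tclass_in_ideal_one_iff: "tclass W p \<in> I \<longleftrightarrow> tclass s (proj p) = tclass s 0"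
proof
  interpret ring_hom_ring TW "tensor_algebra s" "tmap s fst"
    by (rule ring_hom_ringI2[OF ring_tensor_algebra ring_tensor_algebra tmap_ring_hom[OF linear_mod_fst]])
  have "I \<subseteq> a_kernel TW (tensor_algebra s) (tmap s fst)"
    unfolding ideal_one_def
  proof (rule ring.genideal_minimal[OF ring_tensor_algebra kernel_is_ideal])
    have "tmap s fst (pure W [one]) = tclass s (gen 0)"
      unfolding tensor_algebra_simps(8) tmap_tclass[OF linear_mod_fst]
      by (simp add: word_map_simps gen_def)
    also have "\<dots> = tclass s 0"
      by (rule linear_mod_at_zero[OF linear_mod_gen])
    finally have "tmap s fst (pure W [one]) = \<zero>\<^bsub>tensor_algebra s\<^esub>"
      by (simp only: tensor_algebra_simps(4))
    moreover have "pure W [one] \<in> carrier TW"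
      by (simp only: tensor_algebra_simps(5,8))
    ultimately show "{pure W [one]} \<subseteq> a_kernel TW (tensor_algebra s) (tmap s fst)"
      unfolding a_kernel_def' by blast
  qed
  then have "tmap s fst x = tclass s 0" if "x \<in> I" for x
    using that unfolding a_kernel_def' tensor_algebra_simps(4) by blast
  then show "tclass s (proj p) = tclass s 0" if "tclass W p \<in> I"
    using that unfolding tmap_tclass[OF linear_mod_fst, symmetric] by blast
  assume "tclass s (proj p) = tclass s 0"
  from incl_cong_mod[OF this] have "tclass W (incl (proj p)) = tclass W 0"
    by (simp only: word_map_simps)
  then have "tclass W (incl (proj p)) \<in> I"
    by (simp add: ideal_one_closed)
  then show "tclass W p \<in> I"
    using ideal_one_closed(1)[OF diff_in_ideal_one, of "incl (proj p)" p] by simp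
qed

lemma proj_ext_D: "tclass s (proj (ext_D x)) = tclass s (D (fst x))"
proof -
  let ?z = "gen 0 :: 'w list \<Rightarrow>\<^sub>0 'k" and ?v = "gen (fst x) :: 'w list \<Rightarrow>\<^sub>0 'k"
  have z: "tclass s ?z = tclass s 0"
    by (rule linear_mod_at_zero[OF linear_mod_gen])
  have "proj (ext_D x) = D (fst x) + ?z * ?v + ?v * ?z + scal (snd x) (?z * ?z)"
    by (simp add: ext_D_def word_map_simps word_map_mult word_map_comp comp_def word_map_id)
  also have "tclass s \<dots> = tclass s (D (fst x) + 0 * ?v + ?v * 0 + scal (snd x) (0 * ?z))"
    by (intro tclass_add_cong tclass_mult_cong tclass_scal_cong refl z)
  finally show ?thesis
    by (simp add: scal_simps)
qed

lemma proj_codiff: "tclass s (proj (codiff ext_D ws)) = tclass s (codiff D (map fst ws))"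
proof (induction ws)
  case (Cons w ws)
  have "proj (codiff ext_D (w # ws))
      = - (proj (ext_D w) * word (map fst ws)) - gen (fst w) * proj (codiff ext_D ws)"
    by (simp add: word_map_simps word_map_mult)
  also have "tclass s \<dots> = tclass s (codiff D (map fst (w # ws)))"
    unfolding list.map codiff.simps
    by (intro tclass_diff_cong tclass_uminus_cong tclass_mult_cong proj_ext_D Cons refl)
  finally show ?case .
qed (simp add: word_map_simps)

text \<open>
  The projection to \<open>V\<close> is a chain map from the braided differential to the derivation \<open>\<partial>\<close> of \<open>(V, \<delta>)\<close>:
  it sends \<open>\<one>\<close> to \<open>0\<close>, hence \<open>\<one> x\<close> to \<open>0\<close> and \<open>\<Delta>(v)\<close> to \<open>\<delta>(v)\<close>.
\<close>

lemma proj_braided_word: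
  "tclass s (proj (plin ext.braided_word p)) = tclass s (plin (codiff D) (proj p))"
proof (induction p rule: words_induct)
  case (word ws)
  have "tclass s (gen (0::'w)) = tclass s 0"
    by (rule linear_mod_at_zero[OF linear_mod_gen])
  then have "tclass s (gen 0 * word (map fst ws) + proj (codiff ext_D ws))
      = tclass s (0 * word (map fst ws) + codiff D (map fst ws))"
    by (intro tclass_add_cong tclass_mult_cong proj_codiff refl)
  then show ?case
    by (simp add: plin_word ext.braided_word_def word_map_simps word_map_mult)
next
  case (add p q)
  then show ?case using tclass_add_cong[OF add] by (simp add: plin_simps word_map_simps)
next
  case (scal c p)
  then show ?case using tclass_scal_cong[OF scal] by (simp add: plin_simps word_map_simps)
qed (simp add: plin_simps word_map_simps)

lemma proj_braided_word_cong:
  assumes "tclass s (proj p) = tclass s (proj q)"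
  shows "tclass s (proj (plin ext.braided_word p)) = tclass s (proj (plin ext.braided_word q))"
  unfolding proj_braided_word
  by (rule plin_cong_mod[OF multilinear_mod_codiff[OF linear_D] assms])

abbreviation d where "d \<equiv> left_braided_diff W ext.\<sigma> one"

text \<open>
  The kernel of a chain map is stable.
\<close>

lemma left_braided_diff_ideal_one: "d ` I \<subseteq> I"
proof
  fix y assume "y \<in> d ` I"
  then obtain x where x: "x \<in> I" "y = d x"
    by blast
  have "x \<in> carrier TW"
    using x(1) ideal.Icarr[OF ideal_ideal_one] by blast
  then obtain p where p: "x = tclass W p"
    by (rule tclass_surj)
  have "tclass s (proj (plin ext.braided_word p)) = tclass s (proj (plin ext.braided_word 0))"
    using x(1) by (intro proj_braided_word_cong) (simp add: p tclass_in_ideal_one_iff word_map_simps)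
  then show "y \<in> I"
    by (simp add: x(2) p ext.left_braided_diff_tclass tclass_in_ideal_one_iff plin_simps word_map_simps)
qed

section \<open>The differential induced on the quotient\<close>

abbreviation coset where "coset p \<equiv> I +>\<^bsub>TW\<^esub> tclass W p"

lemma coset_eq_iff: "coset p = coset q \<longleftrightarrow> tclass s (proj p) = tclass s (proj q)"
proof -
  have "coset p = coset q \<longleftrightarrow> tclass W (p - q) \<in> I"
    using ring.quotient_eq_iff_same_a_r_cos[OF ring_tensor_algebra ideal_ideal_one
        tensor_algebra_simps(5) tensor_algebra_simps(5), of p q]
    by (simp add: tensor_algebra_minus)
  then show ?thesis
    using tclass_eq_iff_diff[of s "proj p"] by (simp add: tclass_in_ideal_one_iff word_map_simps)
qed

text \<open>
  The projections of \<open>V \<oplus> k\<one>\<close> to its quotient and to \<open>V\<close> factor through each other, so they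
  induce maps with the same kernel.
\<close>

lemma quot_proj_eq_iff:
  "tclass (quot_scale s) (word_map quot_proj p) = tclass (quot_scale s) (word_map quot_proj q)
     \<longleftrightarrow> tclass s (proj p) = tclass s (proj q)"
proof
  assume "tclass (quot_scale s) (word_map quot_proj p) = tclass (quot_scale s) (word_map quot_proj q)"
  from word_map_cong_mod[OF linear_mod_quot_to_V this]
  show "tclass s (proj p) = tclass s (proj q)"
    by (simp add: word_map_comp comp_def)
next
  assume "tclass s (proj p) = tclass s (proj q)"
  from word_map_cong_mod[OF linear_mod_quot_proj_incl[OF vector_space] this]
  show "tclass (quot_scale s) (word_map quot_proj p) = tclass (quot_scale s) (word_map quot_proj q)"
    by (simp add: word_map_comp comp_def)
qed

lemma coset_cases:
  assumes "X \<in> carrier (TW Quot I)"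
  obtains p where "X = coset p"
proof -
  obtain x where x: "x \<in> carrier TW" "X = I +>\<^bsub>TW\<^esub> x"
    using assms unfolding FactRing_simps by auto
  then show thesis
    using that tclass_surj by metis
qed

lemma coset_in_carrier: "coset p \<in> carrier (TW Quot I)"
  unfolding FactRing_simps by (auto simp: tensor_algebra_simps)

abbreviation \<phi> where "\<phi> \<equiv> induced_map (tmap (quot_scale s) quot_proj)"

abbreviation \<psi> where "\<psi> \<equiv> tmap s quot_to_V"

abbreviation d_quot where "d_quot \<equiv> induced_endo TW I d"

lemma phi_coset: "\<phi> (coset p) = tclass (quot_scale s) (word_map quot_proj p)"
proof -
  interpret ideal I TW by (rule ideal_ideal_one)
  have "\<phi> (coset p) = tmap (quot_scale s) quot_proj (tclass W p)"
    unfolding induced_map_def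
  proof (rule the_elem_image_coset)
    fix y assume "y \<in> carrier TW" and y: "I +>\<^bsub>TW\<^esub> y = coset p"
    then obtain q where "y = tclass W q"
      by (elim tclass_surj)
    with y show "tmap (quot_scale s) quot_proj y = tmap (quot_scale s) quot_proj (tclass W p)"
      by (simp add: tmap_tclass[OF linear_mod_quot_proj] coset_eq_iff quot_proj_eq_iff)
  qed (simp add: tensor_algebra_simps)
  then show ?thesis
    by (simp add: tmap_tclass[OF linear_mod_quot_proj])
qed

lemma psi_tclass: "\<psi> (tclass (quot_scale s) p) = tclass s (word_map quot_to_V p)"
  by (rule tmap_tclass[OF linear_mod_quot_to_V])

lemma d_quot_coset: "d_quot (coset p) = coset (plin ext.braided_word p)"
proof -
  interpret ideal I TW by (rule ideal_ideal_one)
  have "d_quot (coset p) = I +>\<^bsub>TW\<^esub> d (tclass W p)"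
    unfolding induced_endo_def
  proof (rule the_elem_image_coset)
    fix y assume "y \<in> carrier TW" and y: "I +>\<^bsub>TW\<^esub> y = coset p"
    then obtain q where q: "y = tclass W q"
      by (elim tclass_surj)
    show "I +>\<^bsub>TW\<^esub> d y = I +>\<^bsub>TW\<^esub> d (tclass W p)"
      using y unfolding q ext.left_braided_diff_tclass coset_eq_iff by (rule proj_braided_word_cong)
  qed (simp add: tensor_algebra_simps)
  then show ?thesis
    by (simp add: ext.left_braided_diff_tclass)
qed

lemma psi_phi_coset: "\<psi> (\<phi> (coset p)) = tclass s (proj p)"
  by (simp add: phi_coset psi_tclass word_map_comp comp_def)

lemma proj_incl: "proj (incl p) = p"
  by (simp add: word_map_comp comp_def word_map_id)

lemma algebra_iso_phi:
  "algebra_iso (TW Quot I) (\<lambda>c. I +>\<^bsub>TW\<^esub> tscalar W c) (tensor_algebra (quot_scale s))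
     (tscalar (quot_scale s)) \<phi>"
proof -
  note hom = ideal.rcos_ring_hom[OF ideal_ideal_one]
  have mult: "coset p \<otimes>\<^bsub>TW Quot I\<^esub> coset q = coset (p * q)" for p q
    using ring_hom_mult[OF hom tensor_algebra_simps(5) tensor_algebra_simps(5), of p q]
    by (simp add: tensor_algebra_simps)
  have add: "coset p \<oplus>\<^bsub>TW Quot I\<^esub> coset q = coset (p + q)" for p q
    using ring_hom_add[OF hom tensor_algebra_simps(5) tensor_algebra_simps(5), of p q]
    by (simp add: tensor_algebra_simps)
  have one: "\<one>\<^bsub>TW Quot I\<^esub> = coset 1"
    using ring_hom_one[OF hom] by (simp add: tensor_algebra_simps)
  have "\<phi> \<in> ring_hom (TW Quot I) (tensor_algebra (quot_scale s))"
    by (rule ring_hom_memI)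
      (auto elim!: coset_cases simp: mult add one phi_coset tensor_algebra_simps word_map_simps
        word_map_mult)
  moreover have "bij_betw \<phi> (carrier (TW Quot I)) (carrier (tensor_algebra (quot_scale s)))"
    unfolding bij_betw_def
  proof
    show "inj_on \<phi> (carrier (TW Quot I))"
    proof (rule inj_onI)
      fix X Y assume "X \<in> carrier (TW Quot I)" "Y \<in> carrier (TW Quot I)" and eq: "\<phi> X = \<phi> Y"
      then obtain p q where pq: "X = coset p" "Y = coset q"
        by (elim coset_cases)
      from eq show "X = Y"
        unfolding pq phi_coset quot_proj_eq_iff coset_eq_iff .
    qed
    have "tclass (quot_scale s) p \<in> \<phi> ` carrier (TW Quot I)" for p
    proof -
      have "tclass (quot_scale s) p = \<phi> (coset (incl (word_map quot_to_V p)))"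
        by (simp add: phi_coset word_map_comp comp_def word_map_id)
      then show ?thesis
        using coset_in_carrier by blast
    qed
    then show "\<phi> ` carrier (TW Quot I) = carrier (tensor_algebra (quot_scale s))"
      by (auto elim!: coset_cases tclass_surj simp: phi_coset tensor_algebra_simps)
  qed
  ultimately show ?thesis
    by (simp add: algebra_iso_def ring_iso_def tensor_algebra_simps phi_coset word_map_simps)
qed

lemma algebra_iso_psi:
  "algebra_iso (tensor_algebra (quot_scale s)) (tscalar (quot_scale s)) (tensor_algebra s) (tscalar s) \<psi>"
proof -
  let ?Q = "quot_scale s"
  let ?r = "word_map (\<lambda>v. quot_proj (ext_incl v)) :: ('w list \<Rightarrow>\<^sub>0 'k) \<Rightarrow> _"
  have inv: "?r (word_map quot_to_V p) = p" "word_map quot_to_V (?r q) = q" for p q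
    by (simp_all add: word_map_comp comp_def word_map_id)
  have "bij_betw \<psi> (carrier (tensor_algebra ?Q)) (carrier (tensor_algebra s))"
    unfolding bij_betw_def
  proof
    show "inj_on \<psi> (carrier (tensor_algebra ?Q))"
    proof (rule inj_onI)
      fix x y assume "x \<in> carrier (tensor_algebra ?Q)" "y \<in> carrier (tensor_algebra ?Q)"
        and eq: "\<psi> x = \<psi> y"
      then obtain p q where pq: "x = tclass ?Q p" "y = tclass ?Q q"
        by (elim tclass_surj)
      from eq have "tclass s (word_map quot_to_V p) = tclass s (word_map quot_to_V q)"
        by (simp add: pq psi_tclass)
      from word_map_cong_mod[OF linear_mod_quot_proj_incl[OF vector_space] this]
      show "x = y"
        by (simp add: pq inv)
    qed
    have "tclass s p \<in> \<psi> ` carrier (tensor_algebra ?Q)" for p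
    proof -
      have "tclass s p = \<psi> (tclass ?Q (?r p))"
        by (simp add: psi_tclass inv)
      then show ?thesis
        using tensor_algebra_simps(5) by blast
    qed
    then show "\<psi> ` carrier (tensor_algebra ?Q) = carrier (tensor_algebra s)"
      by (auto elim!: tclass_surj simp: psi_tclass tensor_algebra_simps)
  qed
  then show ?thesis
    using tmap_ring_hom[OF linear_mod_quot_to_V]
    by (simp add: algebra_iso_def ring_iso_def tensor_algebra_simps psi_tclass word_map_simps)
qed

text \<open>
  Any preimage \<open>q\<close> of the class of \<open>p\<close> may serve to compute the transported map, and the chain map
  property evaluates it.
\<close>

lemma transported_differential:
  "(\<psi> \<circ> \<phi>) (d_quot (inv_into (carrier (TW Quot I)) (\<psi> \<circ> \<phi>) (tclass s p))) = tclass s (plin (codiff D) p)"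
proof -
  let ?X = "inv_into (carrier (TW Quot I)) (\<psi> \<circ> \<phi>) (tclass s p)"
  have "(\<psi> \<circ> \<phi>) (coset (incl p)) = tclass s p"
    by (simp add: psi_phi_coset proj_incl)
  then have "tclass s p \<in> (\<psi> \<circ> \<phi>) ` carrier (TW Quot I)"
    using coset_in_carrier by (metis imageI)
  then have X: "?X \<in> carrier (TW Quot I)" "(\<psi> \<circ> \<phi>) ?X = tclass s p"
    by (rule inv_into_into, rule f_inv_into_f)
  from X(1) obtain q where q: "?X = coset q"
    by (rule coset_cases)
  have "tclass s (proj q) = tclass s p"
    using X(2) unfolding q by (simp add: psi_phi_coset)
  from plin_cong_mod[OF multilinear_mod_codiff[OF linear_D] this]
  show ?thesis
    unfolding q by (simp add: d_quot_coset psi_phi_coset proj_braided_word)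
qed

end

theorem proposition5p16:
  fixes s :: "'k::field \<Rightarrow> 'v::ab_group_add \<Rightarrow> 'v"
    and \<delta> :: "'v \<Rightarrow> ('v list \<Rightarrow>\<^sub>0 'k) set"
  assumes "coassociative_coalgebra s \<delta>"
  shows
    "let W = ext_scale s; TW = tensor_algebra W; \<Delta> = ext_comult s \<delta>; \<epsilon> = ext_counit;
         \<sigma> = sigma_coAss W \<Delta> \<epsilon>; d = left_braided_diff W \<sigma> ext_one;
         I = ideal_one s; TV = tensor_algebra s;
         Q = quot_scale s; TQ = tensor_algebra Q;
         \<phi> = induced_map (tmap Q quot_proj); \<psi> = tmap s quot_to_V; \<theta> = \<psi> \<circ> \<phi>;
         dI = induced_endo TW I d;
         dV = (\<lambda>y. \<theta> (dI (inv_into (carrier (TW Quot I)) \<theta> y)))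
     in
       counital_coalgebra W \<Delta> \<epsilon> \<and> group_like W \<Delta> \<epsilon> ext_one \<and>
       pre_braiding W \<sigma> \<and> braided_cocharacter W \<sigma> ext_one \<and>
       tensor_differential W d \<and>
       (\<forall>ws. d (pure W ws) =
          pure W (ext_one # ws) \<oplus>\<^bsub>TW\<^esub>
          (\<Oplus>\<^bsub>TW\<^esub> i\<in>{1..length ws}. tscale W ((-1) ^ i)
             (pure W (take (i - 1) ws) \<otimes>\<^bsub>TW\<^esub> \<Delta> (ws ! (i - 1)) \<otimes>\<^bsub>TW\<^esub> pure W (drop i ws)))) \<and>
       d ` I \<subseteq> I \<and>
       algebra_iso (TW Quot I) (\<lambda>c. I +>\<^bsub>TW\<^esub> tscalar W c) TQ (tscalar Q) \<phi> \<and>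
       (\<forall>x\<in>carrier TW. \<phi> (I +>\<^bsub>TW\<^esub> x) = tmap Q quot_proj x) \<and>
       (\<forall>ws. \<phi> (I +>\<^bsub>TW\<^esub> pure W ws) = pure Q (map quot_proj ws)) \<and>
       algebra_iso TQ (tscalar Q) TV (tscalar s) \<psi> \<and>
       (\<forall>vs. \<psi> (pure Q (map (quot_proj \<circ> ext_incl) vs)) = pure s vs) \<and>
       (\<forall>x\<in>carrier TW. dI (I +>\<^bsub>TW\<^esub> x) = I +>\<^bsub>TW\<^esub> d x) \<and>
       tensor_differential s dV \<and>
       (\<forall>vs. dV (pure s vs) =
          (\<Oplus>\<^bsub>TV\<^esub> i\<in>{1..length vs}. tscale s ((-1) ^ i)
             (pure s (take (i - 1) vs) \<otimes>\<^bsub>TV\<^esub> \<delta> (vs ! (i - 1)) \<otimes>\<^bsub>TV\<^esub> pure s (drop i vs))))"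
proof -
  obtain D where "coalgebra_reps s D" and \<delta>: "\<delta> = (\<lambda>v. tclass s (D v))"
    by (rule coalgebra_repsE[OF assms])
  then interpret coalgebra_extension s D
    by (simp add: coalgebra_extension_def)
  have d_formula: "d (pure W ws) = pure W (ext_one # ws) \<oplus>\<^bsub>TW\<^esub> tclass W (codiff ext_D ws)" for ws
    by (simp add: tensor_algebra_simps ext.left_braided_diff_tclass plin_word ext.braided_word_def
        word_Cons)
  have phi: "\<phi> (I +>\<^bsub>TW\<^esub> x) = tmap (quot_scale s) quot_proj x" if "x \<in> carrier TW" for x
    using that by (rule tclass_surj) (simp add: phi_coset tmap_tclass[OF linear_mod_quot_proj])
  have phi_pure: "\<phi> (I +>\<^bsub>TW\<^esub> pure W ws) = pure (quot_scale s) (map quot_proj ws)" for ws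
    by (simp add: tensor_algebra_simps(8) phi_coset word_map_simps)
  have psi_pure: "\<psi> (pure (quot_scale s) (map (quot_proj \<circ> ext_incl) vs)) = pure s vs" for vs
    by (simp add: tensor_algebra_simps(8) psi_tclass word_map_simps comp_def)
  have d_quot: "d_quot (I +>\<^bsub>TW\<^esub> x) = I +>\<^bsub>TW\<^esub> d x" if "x \<in> carrier TW" for x
    using that by (rule tclass_surj) (simp add: d_quot_coset ext.left_braided_diff_tclass)
  have dV: "tensor_differential s
      (\<lambda>y. (\<psi> \<circ> \<phi>) (d_quot (inv_into (carrier (TW Quot I)) (\<psi> \<circ> \<phi>) y)))"
    using homogeneous_codiff[of D, OF homogeneous_D] plin_codiff_square
    by (rule tensor_differentialI[OF transported_differential])
  have dV_pure: "(\<psi> \<circ> \<phi>) (d_quot (inv_into (carrier (TW Quot I)) (\<psi> \<circ> \<phi>) (pure s vs)))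
      = tclass s (codiff D vs)" for vs
    unfolding tensor_algebra_simps(8) transported_differential plin_word ..
  show ?thesis
    unfolding Let_def \<delta> ext_comult_eq finsum_codiff
    by (intro conjI allI ballI ext.counital_coalgebra ext.group_like ext.pre_braiding_sigma
        ext.braided_cocharacter ext.tensor_differential_left_braided_diff d_formula
        left_braided_diff_ideal_one algebra_iso_phi phi phi_pure algebra_iso_psi psi_pure d_quot
        dV dV_pure)
qed

end
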